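(* Let $\alpha,\beta\in[0,2\pi)$ and let $$Bu=\bigcup_{k\in[0,2\pi)}\{(k,\theta): e^{i\theta}\in\sigma_c^{(k)}\},\qquad Ed=\bigcup_{k\in[0,2\pi)}\{(k,\theta): e^{i\theta}\in\sigma_p^{(k)}\},$$ where $\sigma_c^{(k)}$ and $\sigma_p^{(k)}$ are the continuous and point spectra of the CMV matrix $\mathcal{C}_k$ for fixed $k$. Then (with $\theta$ taken modulo $2\pi$) $$Bu=\bigcup_{k\in[0,2\pi)}\{k\}\times\Big([\theta_c(k),\pi-\theta_c(k)]\cup[\pi+\theta_c(k),2\pi-\theta_c(k)]\Big),$$ $$Ed=\begin{cases}\{(k,\theta_0(k)): k\in[0,2\pi)\setminus\{\pi/2,3\pi/2\}\}&\text{if }\sin(\alpha+\beta)\neq0,\\ \emptyset&\text{if }\sin(\alpha+\beta)=0.\end{cases}$$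
   Context: For $k\in[0,2\pi)$ let $\eta(k)=-\cos k\,\sin(\alpha+\beta)+i\sin k\,\sin(\alpha-\beta)$ and $\rho(k)=\sqrt{1-|\eta(k)|^2}=\sqrt{\cos^2(\alpha-\beta)-\sin2\alpha\sin2\beta\cos^2k}$. $\mathcal{C}_k$ is the CMV matrix with Verblunsky parameters $(\eta(k),0,\eta(k),0,\dots)$, i.e. the matrix acting on $\ell^2(\mathbb{Z}_+)$, $\mathbb{Z}_+=\{0,1,2,\dots\}$, with (writing $\eta=\eta(k)$, $\rho=\rho(k)$) $$\mathcal{C}_{0,0}=\overline\eta,\ \mathcal{C}_{0,2}=\rho,\ \mathcal{C}_{1,0}=\rho,\ \mathcal{C}_{1,2}=-\eta,$$ $$\mathcal{C}_{2j,2j-1}=\overline\eta,\ \mathcal{C}_{2j,2j+2}=\rho,\ \mathcal{C}_{2j+1,2j-1}=\rho,\ \mathcal{C}_{2j+1,2j+2}=-\eta\quad(j\ge1),$$ and all other entries $0$. $\theta_c(k)=\arccos(\rho(k))$, and $$\theta_0(k)=\begin{cases}\arcsin(-\sin k\,\sin(\alpha-\beta))&\text{if }\cos k\,\sin(\alpha+\beta)\le0,\\ \pi-\arcsin(-\sin k\,\sin(\alpha-\beta))&\text{if }\cos k\,\sin(\alpha+\beta)>0.\end{cases}$$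
   Formalization: All unions over k are restricted to those k in [0,2π) with |η(k)|<1; where |η(k)|=1 (e.g. α=β=π/4, k=0) the matrix decouples, has pure point spectrum containing ±i, and the claimed formulas for Bu and Ed fail. *)

theory Defs
  imports "HOL-Analysis.Analysis"
begin

section \<open>Spectra of matrices acting on the sequence space l2\<close>

definition ell2 :: "(nat \<Rightarrow> complex) set" where
  "ell2 = {u. summable (\<lambda>n. (cmod (u n))\<^sup>2)}"

definition ell2_norm :: "(nat \<Rightarrow> complex) \<Rightarrow> real" where
  "ell2_norm u = sqrt (\<Sum>n. (cmod (u n))\<^sup>2)"

text \<open>Below this is only used for matrices whose rows have finitely many nonzero entries, so that
  convergence of the row sums is not an issue.\<close>

definition mat_apply :: "(nat \<Rightarrow> nat \<Rightarrow> complex) \<Rightarrow> (nat \<Rightarrow> complex) \<Rightarrow> nat \<Rightarrow> complex" where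
  "mat_apply A u = (\<lambda>m. \<Sum>n. A m n * u n)"

definition shifted_range :: "(nat \<Rightarrow> nat \<Rightarrow> complex) \<Rightarrow> complex \<Rightarrow> (nat \<Rightarrow> complex) set" where
  "shifted_range A z = (\<lambda>u n. mat_apply A u n - z * u n) ` ell2"

definition point_spectrum :: "(nat \<Rightarrow> nat \<Rightarrow> complex) \<Rightarrow> complex set" where
  "point_spectrum A = {z. \<exists>u\<in>ell2. u \<noteq> (\<lambda>n. 0) \<and> mat_apply A u = (\<lambda>n. z * u n)}"

text \<open>The classical notion for a matrix that defines a bounded operator on l2: the shifted operator
  is injective with dense range, but not onto.\<close>

definition continuous_spectrum :: "(nat \<Rightarrow> nat \<Rightarrow> complex) \<Rightarrow> complex set" where
  "continuous_spectrum A = {z. z \<notin> point_spectrum A \<and> shifted_range A z \<noteq> ell2 \<and>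
     (\<forall>v\<in>ell2. \<forall>e>0. \<exists>w\<in>shifted_range A z. ell2_norm (\<lambda>n. v n - w n) < e)}"


section \<open>The CMV matrices\<close>

definition eta :: "real \<Rightarrow> real \<Rightarrow> real \<Rightarrow> complex" where
  "eta \<alpha> \<beta> k = Complex (- cos k * sin (\<alpha> + \<beta>)) (sin k * sin (\<alpha> - \<beta>))"

definition rho :: "real \<Rightarrow> real \<Rightarrow> real \<Rightarrow> real" where
  "rho \<alpha> \<beta> k = sqrt (1 - (cmod (eta \<alpha> \<beta> k))\<^sup>2)"

text \<open>The four conditions are mutually exclusive.\<close>

definition cmv_matrix :: "complex \<Rightarrow> real \<Rightarrow> nat \<Rightarrow> nat \<Rightarrow> complex" where
  "cmv_matrix \<eta> \<rho> m n =
     (if (m = 0 \<and> n = 0) \<or> (\<exists>j\<ge>1. m = 2 * j \<and> n = 2 * j - 1) then cnj \<eta>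
      else if (\<exists>j. m = 2 * j \<and> n = 2 * j + 2) then of_real \<rho>
      else if (m = 1 \<and> n = 0) \<or> (\<exists>j\<ge>1. m = 2 * j + 1 \<and> n = 2 * j - 1) then of_real \<rho>
      else if (\<exists>j. m = 2 * j + 1 \<and> n = 2 * j + 2) then - \<eta>
      else 0)"

definition cmv :: "real \<Rightarrow> real \<Rightarrow> real \<Rightarrow> nat \<Rightarrow> nat \<Rightarrow> complex" where
  "cmv \<alpha> \<beta> k = cmv_matrix (eta \<alpha> \<beta> k) (rho \<alpha> \<beta> k)"

text \<open>Verblunsky parameters of a CMV matrix lie in the open unit disc by definition. We keep
  exactly the values of k for which this holds; the lemma \<open>momenta_eq_all\<close> below shows that none is lost
  unless the absolute value of one of the two sines is 1. Where the modulus of eta is 1 the matrix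
  above decouples into blocks of size 1 and 2: it has pure point spectrum, with eigenvalues i and -i
  of infinite multiplicity (cf. \<open>degenerate_eigenvalue\<close>).\<close>

definition momenta :: "real \<Rightarrow> real \<Rightarrow> real set" where
  "momenta \<alpha> \<beta> = {k \<in> {0..<2 * pi}. cmod (eta \<alpha> \<beta> k) < 1}"

definition theta_c :: "real \<Rightarrow> real \<Rightarrow> real \<Rightarrow> real" where
  "theta_c \<alpha> \<beta> k = arccos (rho \<alpha> \<beta> k)"

definition theta_0 :: "real \<Rightarrow> real \<Rightarrow> real \<Rightarrow> real" where
  "theta_0 \<alpha> \<beta> k =
     (if cos k * sin (\<alpha> + \<beta>) \<le> 0 then arcsin (- sin k * sin (\<alpha> - \<beta>))
      else pi - arcsin (- sin k * sin (\<alpha> - \<beta>)))"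

definition Bulk :: "real \<Rightarrow> real \<Rightarrow> (real \<times> real) set" where
  "Bulk \<alpha> \<beta> = (\<Union>k\<in>momenta \<alpha> \<beta>. {(k, \<theta>) |\<theta>. cis \<theta> \<in> continuous_spectrum (cmv \<alpha> \<beta> k)})"

definition Edge :: "real \<Rightarrow> real \<Rightarrow> (real \<times> real) set" where
  "Edge \<alpha> \<beta> = (\<Union>k\<in>momenta \<alpha> \<beta>. {(k, \<theta>) |\<theta>. cis \<theta> \<in> point_spectrum (cmv \<alpha> \<beta> k)})"

text \<open>Angles are taken modulo 2 pi: a set of pairs is replaced by all its translates in the second
  component. Bulk and Edge are invariant under these translations by construction.\<close>

definition mod_2pi :: "(real \<times> real) set \<Rightarrow> (real \<times> real) set" where
  "mod_2pi S = {(k, \<theta> + 2 * pi * of_int n) |k \<theta> n. (k, \<theta>) \<in> S}"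


section \<open>Basic facts\<close>

lemma cmod_eta_sq:
  "(cmod (eta \<alpha> \<beta> k))\<^sup>2 = (cos k)\<^sup>2 * (sin (\<alpha> + \<beta>))\<^sup>2 + (sin k)\<^sup>2 * (sin (\<alpha> - \<beta>))\<^sup>2"
  by (simp add: eta_def cmod_power2 power_mult_distrib)

lemma rho_eq:
  "rho \<alpha> \<beta> k = sqrt ((cos (\<alpha> - \<beta>))\<^sup>2 - sin (2 * \<alpha>) * sin (2 * \<beta>) * (cos k)\<^sup>2)"
proof -
  have "(sin (\<alpha> + \<beta>))\<^sup>2 - (sin (\<alpha> - \<beta>))\<^sup>2 = sin (2 * \<alpha>) * sin (2 * \<beta>)"
    unfolding sin_add sin_diff sin_double by algebra
  moreover have "(sin k)\<^sup>2 = 1 - (cos k)\<^sup>2" "(cos (\<alpha> - \<beta>))\<^sup>2 = 1 - (sin (\<alpha> - \<beta>))\<^sup>2"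
    by (rule sin_squared_eq, rule cos_squared_eq)
  ultimately have "1 - (cmod (eta \<alpha> \<beta> k))\<^sup>2
      = (cos (\<alpha> - \<beta>))\<^sup>2 - sin (2 * \<alpha>) * sin (2 * \<beta>) * (cos k)\<^sup>2"
    unfolding cmod_eta_sq by algebra
  then show ?thesis by (simp add: rho_def)
qed

lemma momenta_eq_all:
  "momenta \<alpha> \<beta> = {0..<2 * pi} \<longleftrightarrow> \<bar>sin (\<alpha> + \<beta>)\<bar> < 1 \<and> \<bar>sin (\<alpha> - \<beta>)\<bar> < 1"
proof
  assume *: "momenta \<alpha> \<beta> = {0..<2 * pi}"
  have "0 \<in> momenta \<alpha> \<beta>" "pi / 2 \<in> momenta \<alpha> \<beta>"
    unfolding * using pi_gt_zero by simp_all
  then have "(cmod (eta \<alpha> \<beta> 0))\<^sup>2 < 1" "(cmod (eta \<alpha> \<beta> (pi / 2)))\<^sup>2 < 1"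
    by (simp_all add: momenta_def abs_square_less_1 power_less_one_iff)
  then show "\<bar>sin (\<alpha> + \<beta>)\<bar> < 1 \<and> \<bar>sin (\<alpha> - \<beta>)\<bar> < 1"
    by (simp add: cmod_eta_sq abs_square_less_1)
next
  assume *: "\<bar>sin (\<alpha> + \<beta>)\<bar> < 1 \<and> \<bar>sin (\<alpha> - \<beta>)\<bar> < 1"
  have "cmod (eta \<alpha> \<beta> k) < 1" for k
  proof -
    define s where "s = max ((sin (\<alpha> + \<beta>))\<^sup>2) ((sin (\<alpha> - \<beta>))\<^sup>2)"
    have "s < 1" using * by (simp add: s_def abs_square_less_1)
    have "(cmod (eta \<alpha> \<beta> k))\<^sup>2 \<le> (cos k)\<^sup>2 * s + (sin k)\<^sup>2 * s"
      unfolding cmod_eta_sq s_def by (intro add_mono mult_left_mono) auto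
    also have "\<dots> = s"
      by (simp flip: distrib_right)
    finally show ?thesis using \<open>s < 1\<close> abs_square_less_1[of "cmod (eta \<alpha> \<beta> k)"] by simp
  qed
  then show "momenta \<alpha> \<beta> = {0..<2 * pi}"
    by (auto simp: momenta_def)
qed

lemma degenerate_eigenvalue:
  assumes "cmod (eta \<alpha> \<beta> k) = 1"
  shows "\<i> \<in> point_spectrum (cmv \<alpha> \<beta> k)"
proof -
  define h where "h = eta \<alpha> \<beta> k"
  define u :: "nat \<Rightarrow> complex" where "u n = (if n = 1 then \<i> * h else if n = 2 then 1 else 0)" for n
  have rho: "rho \<alpha> \<beta> k = 0" using assms by (simp add: rho_def)
  have h: "cnj h * h = 1" "h * cnj h = 1"
    using assms complex_norm_square[of h] by (simp_all add: h_def mult.commute)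
  have "u \<in> ell2"
    unfolding ell2_def by (auto intro!: summable_finite[of "{1, 2}"] simp: u_def split: if_splits)
  moreover have "u \<noteq> (\<lambda>n. 0)"
    by (auto simp: u_def fun_eq_iff intro: exI[of _ 2])
  moreover have "mat_apply (cmv \<alpha> \<beta> k) u m = \<i> * u m" for m
  proof -
    have "mat_apply (cmv \<alpha> \<beta> k) u m = (\<Sum>n\<in>{1, 2}. cmv \<alpha> \<beta> k m n * u n)"
      unfolding mat_apply_def by (rule suminf_finite) (auto simp: u_def split: if_splits)
    also have "\<dots> = cmv \<alpha> \<beta> k m 1 * (\<i> * h) + cmv \<alpha> \<beta> k m 2"
      by (simp add: u_def)
    also have "cmv \<alpha> \<beta> k m 1 = (if m = 2 then cnj h else 0)"
    proof -
      have "(\<exists>j\<ge>1. m = 2 * j \<and> 1 = 2 * j - 1) \<longleftrightarrow> m = 2" by presburger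
      moreover have "\<not> (\<exists>j. m = 2 * j + 1 \<and> 1 = 2 * j + 2)" by presburger
      ultimately show ?thesis unfolding cmv_def cmv_matrix_def rho h_def by simp
    qed
    also have "cmv \<alpha> \<beta> k m 2 = (if m = 1 then - h else 0)"
    proof -
      have "(\<exists>j. m = 2 * j + 1 \<and> 2 = 2 * j + 2) \<longleftrightarrow> m = 1" by presburger
      moreover have "\<not> (\<exists>j\<ge>1. m = 2 * j \<and> 2 = 2 * j - 1)" by presburger
      ultimately show ?thesis unfolding cmv_def cmv_matrix_def rho h_def by auto
    qed
    also have "(if m = 2 then cnj h else 0) * (\<i> * h) + (if m = 1 then - h else 0) = \<i> * u m"
      using h by (simp add: u_def algebra_simps)
    finally show ?thesis .
  qed
  ultimately show ?thesis unfolding point_spectrum_def by auto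
qed

end

theory Submission
  imports Defs
begin

text \<open>
  With c j = u (2 j) and a j = u (2 j - 1), where a 0 = u 0, the equation (C - z) u = v becomes the
  recursion x (j + 1) = T x j + (source), x = (c, a), with boundary condition c 0 = a 0 and
  T = [[z, - cnj eta], [- eta, 1 / z]] / rho. For z on the circle T lies in SU(1,1) and has trace
  t = 2 Re z / rho. If |t| \<open>\<le>\<close> 2, a conserved quadratic form excludes nonzero decaying solutions, so z
  is no eigenvalue and the first unit vector is not in the range. If |t| > 2, z is an eigenvalue iff
  (1, 1) is the contracting eigenvector of T; otherwise solving forwards in the contracting and
  backwards in the expanding direction inverts C - z. The range is dense unless z is an eigenvalue:
  a finitely supported v orthogonal to the formal eigenvector h is in the range, and orthogonality
  can be arranged by subtracting small multiples of long truncations of h, which is not in l2.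
\<close>

section \<open>Square-summable sequences\<close>

lemma cmod_add_sq_le: "(cmod (x + y))\<^sup>2 \<le> 2 * (cmod x)\<^sup>2 + 2 * (cmod y)\<^sup>2"
proof -
  have "(cmod (x + y))\<^sup>2 \<le> (cmod x + cmod y)\<^sup>2"
    by (intro power_mono norm_triangle_ineq) auto
  also have "\<dots> \<le> 2 * (cmod x)\<^sup>2 + 2 * (cmod y)\<^sup>2"
    using sum_squares_bound[of "cmod x" "cmod y"] by (simp add: power2_sum)
  finally show ?thesis .
qed

lemma ell2_add:
  assumes "u \<in> ell2" "v \<in> ell2"
  shows "(\<lambda>n. u n + v n) \<in> ell2"
proof -
  have "summable (\<lambda>n. 2 * (cmod (u n))\<^sup>2 + 2 * (cmod (v n))\<^sup>2)"
    using assms by (auto simp: ell2_def intro!: summable_add summable_mult)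
  then show ?thesis
    unfolding ell2_def mem_Collect_eq
    by (rule summable_comparison_test'[where N = 0]) (use cmod_add_sq_le in simp)
qed

lemma ell2_mult: "u \<in> ell2 \<Longrightarrow> (\<lambda>n. k * u n) \<in> ell2"
  by (auto simp: ell2_def norm_mult power_mult_distrib intro: summable_mult)

lemma ell2_diff:
  assumes "u \<in> ell2" "v \<in> ell2"
  shows "(\<lambda>n. u n - v n) \<in> ell2"
  using ell2_add[OF assms(1) ell2_mult[OF assms(2), of "-1"]] by simp

lemma ell2_cnj: "(\<lambda>n. cnj (u n)) \<in> ell2 \<longleftrightarrow> u \<in> ell2"
  by (simp add: ell2_def)

lemma ell2_Suc: "(\<lambda>n. u (Suc n)) \<in> ell2 \<longleftrightarrow> u \<in> ell2"
  unfolding ell2_def using summable_Suc_iff[of "\<lambda>n. (cmod (u n))\<^sup>2"] by simp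

lemma ell2_finite_support:
  assumes "\<And>n. n \<ge> N \<Longrightarrow> u n = 0"
  shows "u \<in> ell2"
  unfolding ell2_def mem_Collect_eq
  by (rule summable_finite[of "{..<N}"]) (auto simp: assms not_less)

lemma ell2_tendsto_0:
  assumes "u \<in> ell2"
  shows "u \<longlonglongrightarrow> 0"
proof -
  have "(\<lambda>n. (cmod (u n))\<^sup>2) \<longlonglongrightarrow> 0"
    using assms unfolding ell2_def mem_Collect_eq by (rule summable_LIMSEQ_zero)
  from tendsto_real_sqrt[OF this] show ?thesis
    by (auto intro: tendsto_norm_zero_cancel)
qed

lemma ell2_bounded_partial_sums:
  assumes "\<And>n. (\<Sum>j<n. (cmod (u j))\<^sup>2) \<le> B"
  shows "u \<in> ell2"
  unfolding ell2_def mem_Collect_eq by (rule summableI_nonneg_bounded[of _ B]) (use assms in auto)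

lemma ell2_even: "u \<in> ell2 \<Longrightarrow> (\<lambda>j. u (2 * j)) \<in> ell2"
  using summable_reindex[of "\<lambda>n. (cmod (u n))\<^sup>2" "\<lambda>j. 2 * j"]
  by (simp add: ell2_def o_def inj_def)

lemma ell2_odd: "u \<in> ell2 \<Longrightarrow> (\<lambda>j. u (2 * j + 1)) \<in> ell2"
  using summable_reindex[of "\<lambda>n. (cmod (u n))\<^sup>2" "\<lambda>j. 2 * j + 1"]
  by (simp add: ell2_def o_def inj_def)

text \<open>The truncated index repeats \<open>u 0\<close> at j = 0; a shift by one step removes
  that term.\<close>

lemma ell2_odd_pred: "u \<in> ell2 \<Longrightarrow> (\<lambda>j. u (2 * j - 1)) \<in> ell2"
  using ell2_odd[of u] ell2_Suc[of "\<lambda>j. u (2 * j - 1)"] by simp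

lemma ell2_interleave:
  assumes "(\<lambda>j. u (2 * j)) \<in> ell2" "(\<lambda>j. u (2 * j + 1)) \<in> ell2"
  shows "u \<in> ell2"
proof -
  let ?f = "\<lambda>n. (cmod (u n))\<^sup>2"
  have "summable (\<lambda>n. if even n then ?f (2 * (n div 2)) else ?f (2 * ((n - 1) div 2) + 1))"
    using assms sums_if[of "\<lambda>j. ?f (2 * j + 1)" _ "\<lambda>j. ?f (2 * j)"]
    unfolding ell2_def summable_def by fastforce
  also have "(\<lambda>n. if even n then ?f (2 * (n div 2)) else ?f (2 * ((n - 1) div 2) + 1)) = ?f"
    by (auto simp: fun_eq_iff elim!: oddE)
  finally show ?thesis by (simp add: ell2_def)
qed

section \<open>First-order recursions with a square-summable source\<close>

text \<open>Convexity of the square with weights l and 1 - l at the points x and y / (1 -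
  l).\<close>

lemma weighted_square_ineq:
  fixes l x y :: real
  assumes "0 \<le> l" "l < 1"
  shows "(l * x + y)\<^sup>2 \<le> l * x\<^sup>2 + y\<^sup>2 / (1 - l)"
proof -
  have "(1 - l) * (l * x\<^sup>2 + y\<^sup>2 / (1 - l)) - (1 - l) * (l * x + y)\<^sup>2
      = l * ((1 - l) * x - y)\<^sup>2"
    using assms by (simp add: field_simps power2_eq_square)
  moreover have "0 \<le> l * ((1 - l) * x - y)\<^sup>2"
    using assms by simp
  ultimately have "(1 - l) * (l * x + y)\<^sup>2 \<le> (1 - l) * (l * x\<^sup>2 + y\<^sup>2 / (1 - l))"
    by linarith
  then show ?thesis using assms by simp
qed

lemma cmod_weighted_square_ineq:
  assumes "cmod l < 1"
  shows "(cmod (l * x + y))\<^sup>2 \<le> cmod l * (cmod x)\<^sup>2 + (cmod y)\<^sup>2 / (1 - cmod l)"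
proof -
  have "(cmod (l * x + y))\<^sup>2 \<le> (cmod l * cmod x + cmod y)\<^sup>2"
    by (intro power_mono) (auto simp: norm_triangle_le norm_mult)
  then show ?thesis
    using weighted_square_ineq[of "cmod l" "cmod x" "cmod y"] assms by (meson norm_ge_zero order_trans)
qed

text \<open>With S n the partial sums of |p j|^2, the weighted inequality gives S n \<le> |p 0|^2 +
  |l| S n + G. As |l| < 1, the term |l| S n can be absorbed on the left, which bounds S n
  independently of n.\<close>

lemma ell2_forward_recursion:
  assumes "g \<in> ell2" "cmod l < 1" and rec: "\<And>j. p (Suc j) = l * p j + g j"
  shows "p \<in> ell2"
proof -
  define G where "G = (\<Sum>j. (cmod (g j))\<^sup>2) / (1 - cmod l)"
  have "(\<Sum>j<n. (cmod (p j))\<^sup>2) \<le> ((cmod (p 0))\<^sup>2 + G) / (1 - cmod l)" for n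
  proof -
    let ?S = "\<lambda>n. \<Sum>j<n. (cmod (p j))\<^sup>2"
    have "?S n \<le> ?S (Suc n)" by simp
    also have "\<dots> = (cmod (p 0))\<^sup>2 + (\<Sum>j<n. (cmod (l * p j + g j))\<^sup>2)"
      by (simp only: sum.lessThan_Suc_shift rec)
    also have "\<dots> \<le> (cmod (p 0))\<^sup>2 + (\<Sum>j<n. cmod l * (cmod (p j))\<^sup>2 + (cmod (g j))\<^sup>2 / (1 - cmod l))"
      by (intro add_left_mono sum_mono cmod_weighted_square_ineq assms)
    also have "\<dots> = (cmod (p 0))\<^sup>2 + cmod l * ?S n + (\<Sum>j<n. (cmod (g j))\<^sup>2) / (1 - cmod l)"
      by (simp add: sum.distrib sum_distrib_left sum_divide_distrib)
    also have "\<dots> \<le> (cmod (p 0))\<^sup>2 + cmod l * ?S n + G"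
      unfolding G_def using assms
      by (intro add_left_mono divide_right_mono sum_le_suminf) (auto simp: ell2_def)
    finally have "?S n * (1 - cmod l) \<le> (cmod (p 0))\<^sup>2 + G"
      by (simp add: algebra_simps)
    then show ?thesis using assms by (simp add: pos_le_divide_eq)
  qed
  then show ?thesis by (rule ell2_bounded_partial_sums)
qed

text \<open>The Neumann series in l applied to the shifts of g is the solution; its square sums are
  bounded by the same absorption as in the forward case.\<close>

lemma ell2_backward_recursion:
  assumes g: "g \<in> ell2" and l: "cmod l < 1"
  obtains q where "q \<in> ell2" "\<And>j. q j = l * q (Suc j) + g j"
proof -
  define q where "q j = (\<Sum>i. l ^ i * g (i + j))" for j
  have "Bseq g"
    using ell2_tendsto_0[OF g] by (intro convergent_imp_Bseq) (auto simp: convergent_def)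
  then obtain K where K: "K > 0" "\<And>n. cmod (g n) \<le> K"
    by (auto simp: Bseq_def)
  have geo: "summable (\<lambda>i. K * cmod l ^ i)"
    using l by (intro summable_mult summable_geometric) simp
  have bd: "norm (norm (l ^ i * g (i + j))) \<le> K * cmod l ^ i" for i j
    using K(2)[of "i + j"] by (simp add: norm_mult norm_power mult.commute[of K] mult_left_mono)
  have sm': "summable (\<lambda>i. norm (l ^ i * g (i + j)))" for j
    by (rule summable_comparison_test'[OF geo, of 0]) (use bd in auto)
  then have sm: "summable (\<lambda>i. l ^ i * g (i + j))" for j
    by (rule summable_norm_cancel)
  have rec: "q j = l * q (Suc j) + g j" for j
  proof -
    have "q j = (\<Sum>i. l ^ Suc i * g (Suc i + j)) + g j"
      unfolding q_def by (subst suminf_split_head[OF sm]) simp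
    also have "(\<Sum>i. l ^ Suc i * g (Suc i + j)) = l * q (Suc j)"
      unfolding q_def by (subst suminf_mult[OF sm, symmetric]) (simp add: mult.assoc)
    finally show ?thesis .
  qed
  \<comment> \<open>A bound on q uniform in j: the index shift below brings in |q n|^2 at the upper
    end of the partial sums, in place of a fixed initial value.\<close>
  define B where "B = (\<Sum>i. K * cmod l ^ i)"
  have B: "cmod (q j) \<le> B" for j
  proof -
    have "cmod (q j) \<le> (\<Sum>i. norm (l ^ i * g (i + j)))"
      unfolding q_def by (rule summable_norm[OF sm'])
    also have "\<dots> \<le> B"
      unfolding B_def by (rule suminf_le[OF _ sm' geo]) (use bd in auto)
    finally show ?thesis .
  qed
  define G where "G = (\<Sum>j. (cmod (g j))\<^sup>2) / (1 - cmod l)"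
  have "(\<Sum>j<n. (cmod (q j))\<^sup>2) \<le> (B\<^sup>2 + G) / (1 - cmod l)" for n
  proof -
    let ?S = "\<lambda>n. \<Sum>j<n. (cmod (q j))\<^sup>2"
    have "?S n = (\<Sum>j<n. (cmod (l * q (Suc j) + g j))\<^sup>2)"
      by (simp flip: rec)
    also have "\<dots> \<le> (\<Sum>j<n. cmod l * (cmod (q (Suc j)))\<^sup>2 + (cmod (g j))\<^sup>2 / (1 - cmod l))"
      by (intro sum_mono cmod_weighted_square_ineq l)
    also have "\<dots> = cmod l * (\<Sum>j<n. (cmod (q (Suc j)))\<^sup>2) + (\<Sum>j<n. (cmod (g j))\<^sup>2) / (1 - cmod l)"
      by (simp add: sum.distrib sum_distrib_left sum_divide_distrib)
    also have "\<dots> \<le> cmod l * (?S n + B\<^sup>2) + G"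
    proof (intro add_mono mult_left_mono)
      have "(\<Sum>j<n. (cmod (q (Suc j)))\<^sup>2) \<le> ?S (Suc n)"
        by (simp only: sum.lessThan_Suc_shift) simp
      also have "\<dots> \<le> ?S n + B\<^sup>2"
        using power_mono[OF B, of n 2] by simp
      finally show "(\<Sum>j<n. (cmod (q (Suc j)))\<^sup>2) \<le> ?S n + B\<^sup>2" .
      show "(\<Sum>j<n. (cmod (g j))\<^sup>2) / (1 - cmod l) \<le> G"
        unfolding G_def using g l by (intro divide_right_mono sum_le_suminf) (auto simp: ell2_def)
    qed simp
    also have "\<dots> \<le> cmod l * ?S n + B\<^sup>2 + G"
      using l mult_left_le_one_le[of "B\<^sup>2" "cmod l"] by (simp add: distrib_left)
    finally have "?S n * (1 - cmod l) \<le> B\<^sup>2 + G"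
      by (simp add: algebra_simps)
    then show ?thesis using l by (simp add: pos_le_divide_eq)
  qed
  then have "q \<in> ell2" by (rule ell2_bounded_partial_sums)
  then show thesis using rec by (rule that)
qed

section \<open>Decaying solutions of second-order recurrences with |t| \<le> 2\<close>

text \<open>The Hermitian form Q is conserved, hence 0 by decay. For |t| \<le> 2 it dominates the
  square of |c (j + 1)| - |c j|, so |c j| is constant, and again by decay 0. This covers the
  semidefinite case |t| = 2 as well.\<close>

lemma bounded_real_recurrence_zero:
  fixes c :: "nat \<Rightarrow> complex" and t :: real
  assumes rec: "\<And>j. c (Suc (Suc j)) = t * c (Suc j) - c j"
    and t: "\<bar>t\<bar> \<le> 2" and lim: "c \<longlonglongrightarrow> 0"
  shows "c j = 0"
proof -
  define Q where "Q j = (cmod (c (Suc j)))\<^sup>2 - t * Re (c (Suc j) * cnj (c j)) + (cmod (c j))\<^sup>2" for j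
  have "Q (Suc j) = Q j" for j
    unfolding Q_def rec by (simp add: cmod_power2) algebra
  then have Q: "Q j = Q 0" for j by (induction j) auto
  have "Q \<longlonglongrightarrow> Q 0"
    by (intro tendsto_eventually always_eventually allI Q)
  moreover have "Q \<longlonglongrightarrow> 0\<^sup>2 - t * Re (0 * cnj 0) + 0\<^sup>2"
    unfolding Q_def using LIMSEQ_Suc[OF lim]
    by (intro tendsto_intros tendsto_norm_zero) (use lim in auto)
  ultimately have "Q 0 = 0\<^sup>2 - t * Re (0 * cnj 0) + 0\<^sup>2"
    by (rule LIMSEQ_unique)
  then have Q0: "Q j = 0" for j
    using Q[of j] by simp
  have step: "cmod (c (Suc j)) = cmod (c j)" for j
  proof -
    have "\<bar>t * Re (c (Suc j) * cnj (c j))\<bar> \<le> 2 * (cmod (c (Suc j)) * cmod (c j))"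
      unfolding abs_mult using t abs_Re_le_cmod[of "c (Suc j) * cnj (c j)"]
      by (intro mult_mono) (auto simp: norm_mult)
    then have "(cmod (c (Suc j)) - cmod (c j))\<^sup>2 \<le> Q j"
      by (simp add: Q_def power2_diff)
    then show ?thesis using Q0[of j] by simp
  qed
  have const: "cmod (c j) = cmod (c 0)" for j
    using step by (induction j) auto
  have "(\<lambda>j. cmod (c j)) \<longlonglongrightarrow> cmod (c 0)"
    by (intro tendsto_eventually always_eventually allI const)
  then have "cmod (c 0) = 0"
    using tendsto_norm_zero[OF lim] by (rule LIMSEQ_unique)
  then show ?thesis
    using const[of j] by simp
qed

section \<open>The eigenvalue equation as a two-step recursion\<close>

lemma cmv_matrix_even:
  "cmv_matrix \<eta> \<rho> (2 * j) n =
    (if n = 2 * j - 1 then cnj \<eta> else if n = 2 * j + 2 then of_real \<rho> else 0)"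
proof -
  have 1: "(2 * j = 0 \<and> n = 0) \<or> (\<exists>i\<ge>1. 2 * j = 2 * i \<and> n = 2 * i - 1) \<longleftrightarrow> n = 2 * j - 1"
    by presburger
  have 2: "(\<exists>i. 2 * j = 2 * i \<and> n = 2 * i + 2) \<longleftrightarrow> n = 2 * j + 2"
    by presburger
  have 3: "\<not> ((2 * j = 1 \<and> n = 0) \<or> (\<exists>i\<ge>1. 2 * j = 2 * i + 1 \<and> n = 2 * i - 1))"
    "\<not> (\<exists>i. 2 * j = 2 * i + 1 \<and> n = 2 * i + 2)"
    by presburger+
  show ?thesis unfolding cmv_matrix_def by (simp only: 1 2 3 if_False)
qed

lemma cmv_matrix_odd:
  "cmv_matrix \<eta> \<rho> (2 * j + 1) n =
    (if n = 2 * j - 1 then of_real \<rho> else if n = 2 * j + 2 then - \<eta> else 0)"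
proof -
  have 1: "\<not> ((2 * j + 1 = 0 \<and> n = 0) \<or> (\<exists>i\<ge>1. 2 * j + 1 = 2 * i \<and> n = 2 * i - 1))"
    "\<not> (\<exists>i. 2 * j + 1 = 2 * i \<and> n = 2 * i + 2)"
    by presburger+
  have 2: "(2 * j + 1 = 1 \<and> n = 0) \<or> (\<exists>i\<ge>1. 2 * j + 1 = 2 * i + 1 \<and> n = 2 * i - 1)
      \<longleftrightarrow> n = 2 * j - 1"
    by presburger
  have 3: "(\<exists>i. 2 * j + 1 = 2 * i + 1 \<and> n = 2 * i + 2) \<longleftrightarrow> n = 2 * j + 2"
    by presburger
  show ?thesis unfolding cmv_matrix_def by (simp only: 1 2 3 if_False)
qed

text \<open>The truncated index 2 * j - 1 is 0 for j = 0, which makes the two formulas below uniform.\<close>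

lemma mat_apply_cmv_even:
  "mat_apply (cmv_matrix \<eta> \<rho>) u (2 * j) = cnj \<eta> * u (2 * j - 1) + \<rho> * u (2 * j + 2)"
proof -
  have "mat_apply (cmv_matrix \<eta> \<rho>) u (2 * j)
      = (\<Sum>n\<in>{2 * j - 1, 2 * j + 2}. cmv_matrix \<eta> \<rho> (2 * j) n * u n)"
    unfolding mat_apply_def by (rule suminf_finite) (auto simp: cmv_matrix_even)
  also have "\<dots> = cnj \<eta> * u (2 * j - 1) + \<rho> * u (2 * j + 2)"
    by (subst sum.insert) (auto simp: cmv_matrix_even)
  finally show ?thesis .
qed

lemma mat_apply_cmv_odd:
  "mat_apply (cmv_matrix \<eta> \<rho>) u (2 * j + 1) = \<rho> * u (2 * j - 1) - \<eta> * u (2 * j + 2)"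
proof -
  have "mat_apply (cmv_matrix \<eta> \<rho>) u (2 * j + 1)
      = (\<Sum>n\<in>{2 * j - 1, 2 * j + 2}. cmv_matrix \<eta> \<rho> (2 * j + 1) n * u n)"
    unfolding mat_apply_def by (rule suminf_finite) (auto simp: cmv_matrix_odd simp del: One_nat_def)
  also have "\<dots> = \<rho> * u (2 * j - 1) - \<eta> * u (2 * j + 2)"
    by (subst sum.insert) (auto simp: cmv_matrix_odd simp del: One_nat_def)
  finally show ?thesis .
qed

lemma mat_apply_cmv_ell2:
  assumes "u \<in> ell2"
  shows "mat_apply (cmv_matrix \<eta> \<rho>) u \<in> ell2"
proof (rule ell2_interleave)
  have even: "(\<lambda>j. u (2 * j + 2)) \<in> ell2"
    using ell2_Suc[of "\<lambda>j. u (2 * j)"] ell2_even[OF assms] by simp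
  show "(\<lambda>j. mat_apply (cmv_matrix \<eta> \<rho>) u (2 * j)) \<in> ell2"
    "(\<lambda>j. mat_apply (cmv_matrix \<eta> \<rho>) u (2 * j + 1)) \<in> ell2"
    unfolding mat_apply_cmv_even mat_apply_cmv_odd
    by (rule ell2_add ell2_diff, (rule ell2_mult, rule ell2_odd_pred[OF assms]), rule ell2_mult, rule even)+
qed

lemma shifted_range_cmv_subset: "shifted_range (cmv_matrix \<eta> \<rho>) z \<subseteq> ell2"
proof
  fix v assume "v \<in> shifted_range (cmv_matrix \<eta> \<rho>) z"
  then obtain u where u: "u \<in> ell2" "v = (\<lambda>n. mat_apply (cmv_matrix \<eta> \<rho>) u n - z * u n)"
    unfolding shifted_range_def by blast
  show "v \<in> ell2"
    unfolding u(2) by (rule ell2_diff[OF mat_apply_cmv_ell2[OF u(1)] ell2_mult[OF u(1)]])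
qed

section \<open>Reduction of (C - z) u = v to the transfer recursion\<close>

text \<open>On the circle \<open>cnj z\<close> can stand for 1 / z, so the identities below become
  polynomial consequences of \<open>eta_cnj\<close> and \<open>z_cnj\<close>.\<close>

locale cmv_circle =
  fixes \<eta> z :: complex and \<rho> :: real
  assumes rho_pos: "0 < \<rho>" and rho_sq: "\<rho>\<^sup>2 = 1 - (cmod \<eta>)\<^sup>2" and z_circle: "cmod z = 1"
begin

lemma eta_cnj: "\<eta> * cnj \<eta> = 1 - of_real \<rho> * of_real \<rho>"
proof -
  have "(cmod \<eta>)\<^sup>2 = 1 - \<rho> * \<rho>"
    using rho_sq by (simp add: power2_eq_square)
  then have "\<eta> * cnj \<eta> = of_real (1 - \<rho> * \<rho>)"
    using complex_norm_square[of \<eta>] by (simp only:)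
  then show ?thesis by simp
qed

lemma z_cnj: "z * cnj z = 1"
  using complex_norm_square[of z] z_circle by simp

lemma rho_nz: "complex_of_real \<rho> \<noteq> 0"
  using rho_pos by simp

definition t :: real where "t = 2 * Re z / \<rho>"

lemma rho_t: "of_real \<rho> * of_real t = z + cnj z"
  using rho_pos by (simp add: t_def complex_add_cnj)

text \<open>The recursion x (j + 1) = T x j + source, multiplied by rho to avoid fractions. Here f
  and g are the entries of the right-hand side v at even and odd indices.\<close>

definition transfer ::
  "(nat \<Rightarrow> complex) \<Rightarrow> (nat \<Rightarrow> complex) \<Rightarrow> (nat \<Rightarrow> complex) \<Rightarrow> (nat \<Rightarrow> complex) \<Rightarrow> bool" where
  "transfer c a f g \<longleftrightarrow> (\<forall>j. of_real \<rho> * c (Suc j) = z * c j - cnj \<eta> * a j + f j \<and>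
     of_real \<rho> * a (Suc j) = cnj z * a j - \<eta> * c j - cnj z * \<eta> * f j - cnj z * of_real \<rho> * g j)"

text \<open>Rows 2 j and 2 j + 1 are solved for the new values: the first gives C', and inserting it
  into rho times the second leaves the coefficient |eta|^2 + rho^2 = 1 at A. Backwards, row 2 j + 1
  is recovered up to the factor rho, which cancels.\<close>

lemma transfer_step_iff:
  "cnj \<eta> * A + of_real \<rho> * C' - z * C = F \<and> of_real \<rho> * A - \<eta> * C' - z * A' = G \<longleftrightarrow>
   of_real \<rho> * C' = z * C - cnj \<eta> * A + F \<and>
   of_real \<rho> * A' = cnj z * A - \<eta> * C - cnj z * \<eta> * F - cnj z * of_real \<rho> * G"
  (is "?L \<longleftrightarrow> ?R")
proof
  assume ?L
  then have L: "cnj \<eta> * A + of_real \<rho> * C' - z * C = F" "of_real \<rho> * A - \<eta> * C' - z * A' = G"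
    by auto
  have "of_real \<rho> * A' = cnj z * A - \<eta> * C - cnj z * \<eta> * F - cnj z * of_real \<rho> * G"
    unfolding L[symmetric] using eta_cnj z_cnj by algebra
  then show ?R using L(1) by (auto simp: algebra_simps)
next
  assume R: ?R
  then have "of_real \<rho> * C' = z * C - cnj \<eta> * A + F"
    "of_real \<rho> * A' = cnj z * A - \<eta> * C - cnj z * \<eta> * F - cnj z * of_real \<rho> * G"
    by auto
  then have "of_real \<rho> * (of_real \<rho> * A - \<eta> * C' - z * A' - G) = 0"
    using eta_cnj z_cnj by algebra
  then have "of_real \<rho> * A - \<eta> * C' - z * A' = G"
    using rho_nz by simp
  then show ?L using R by (auto simp: algebra_simps)
qed

text \<open>Both components on the right start at \<open>u 0\<close>, because
  \<open>2 * 0 - 1\<close> is 0; this is the source of the boundary condition c 0 = a 0.\<close>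

lemma shifted_eq_iff_transfer:
  "(\<lambda>n. mat_apply (cmv_matrix \<eta> \<rho>) u n - z * u n) = v \<longleftrightarrow>
   transfer (\<lambda>j. u (2 * j)) (\<lambda>j. u (2 * j - 1)) (\<lambda>j. v (2 * j)) (\<lambda>j. v (2 * j + 1))"
proof -
  have "(\<lambda>n. mat_apply (cmv_matrix \<eta> \<rho>) u n - z * u n) = v \<longleftrightarrow>
      (\<forall>j. mat_apply (cmv_matrix \<eta> \<rho>) u (2 * j) - z * u (2 * j) = v (2 * j) \<and>
           mat_apply (cmv_matrix \<eta> \<rho>) u (2 * j + 1) - z * u (2 * j + 1) = v (2 * j + 1))"
    (is "?L \<longleftrightarrow> ?R")
  proof
    assume ?R
    show ?L
    proof
      fix n show "mat_apply (cmv_matrix \<eta> \<rho>) u n - z * u n = v n"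
        using \<open>?R\<close> by (cases "even n") (auto elim!: evenE oddE)
    qed
  qed auto
  then show ?thesis
    unfolding transfer_def mat_apply_cmv_even mat_apply_cmv_odd transfer_step_iff[symmetric]
    by simp
qed

lemma transfer_imp_shifted_range:
  assumes "transfer c a (\<lambda>j. v (2 * j)) (\<lambda>j. v (2 * j + 1))" "c 0 = a 0" "c \<in> ell2" "a \<in> ell2"
  shows "v \<in> shifted_range (cmv_matrix \<eta> \<rho>) z"
proof -
  \<comment> \<open>The inverse of the splitting. Odd positions store a from index 1 on;
    \<open>a 0\<close> has no place of its own and is read off from \<open>c 0\<close>.\<close>
  define u where "u n = (if even n then c (n div 2) else a (Suc (n div 2)))" for n
  have u: "(\<lambda>j. u (2 * j)) = c" "(\<lambda>j. u (2 * j - 1)) = a" "(\<lambda>j. u (2 * j + 1)) = (\<lambda>j. a (Suc j))"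
  proof -
    have "u (2 * j - 1) = a j" for j
      using assms(2) by (cases j) (auto simp: u_def)
    then show "(\<lambda>j. u (2 * j - 1)) = a" by auto
  qed (auto simp: u_def)
  have "u \<in> ell2"
    by (rule ell2_interleave) (simp_all only: u ell2_Suc assms)
  moreover have "(\<lambda>n. mat_apply (cmv_matrix \<eta> \<rho>) u n - z * u n) = v"
    unfolding shifted_eq_iff_transfer u using assms(1) .
  ultimately show ?thesis unfolding shifted_range_def by blast
qed

lemma shifted_rangeE:
  assumes "v \<in> shifted_range (cmv_matrix \<eta> \<rho>) z"
  obtains c a where "transfer c a (\<lambda>j. v (2 * j)) (\<lambda>j. v (2 * j + 1))" "c 0 = a 0" "c \<in> ell2" "a \<in> ell2"
proof -
  obtain u where "u \<in> ell2" "(\<lambda>n. mat_apply (cmv_matrix \<eta> \<rho>) u n - z * u n) = v"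
    using assms unfolding shifted_range_def by blast
  then show thesis
    using that[of "\<lambda>j. u (2 * j)" "\<lambda>j. u (2 * j - 1)"] ell2_even ell2_odd_pred
    by (simp add: shifted_eq_iff_transfer)
qed

section \<open>Point spectrum\<close>

text \<open>Reflection symmetry of the recursion forces the second component of a solution starting at
  (1, 1) to be the conjugate of the first.\<close>

fun d :: "nat \<Rightarrow> complex" where
  "d 0 = 1"
| "d (Suc j) = (z * d j - cnj \<eta> * cnj (d j)) / \<rho>"

lemma rho_d: "of_real \<rho> * d (Suc j) = z * d j - cnj \<eta> * cnj (d j)"
  using rho_nz by simp

lemma rho_cnj_d: "of_real \<rho> * cnj (d (Suc j)) = cnj z * cnj (d j) - \<eta> * d j"
  using rho_nz by simp

lemma transfer_d: "transfer d (\<lambda>j. cnj (d j)) (\<lambda>j. 0) (\<lambda>j. 0)"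
  unfolding transfer_def rho_d rho_cnj_d by simp

text \<open>Used with k = \<open>c 0\<close> to show that solutions are unique up to a factor, and
  with k chosen at an index N to cut a solution off there.\<close>

lemma transfer_diff_d:
  assumes "transfer c a f g"
  shows "transfer (\<lambda>j. c j - k * d j) (\<lambda>j. a j - k * cnj (d j)) f g"
  unfolding transfer_def
proof (intro allI conjI)
  fix j
  have c: "of_real \<rho> * c (Suc j) = z * c j - cnj \<eta> * a j + f j"
    "of_real \<rho> * a (Suc j) = cnj z * a j - \<eta> * c j - cnj z * \<eta> * f j - cnj z * of_real \<rho> * g j"
    using assms by (auto simp: transfer_def)
  show "of_real \<rho> * (c (Suc j) - k * d (Suc j)) = z * (c j - k * d j) - cnj \<eta> * (a j - k * cnj (d j)) + f j"
    using c(1) rho_d[of j] by algebra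
  show "of_real \<rho> * (a (Suc j) - k * cnj (d (Suc j))) = cnj z * (a j - k * cnj (d j)) - \<eta> * (c j - k * d j)
      - cnj z * \<eta> * f j - cnj z * of_real \<rho> * g j"
    using c(2) rho_cnj_d[of j] by algebra
qed

lemma transfer_zero:
  assumes "transfer c a f g" "c N = 0" "a N = 0" "\<And>j. j \<ge> N \<Longrightarrow> f j = 0 \<and> g j = 0" "j \<ge> N"
  shows "c j = 0 \<and> a j = 0"
  using assms(5)
proof (induction j rule: dec_induct)
  case (step j)
  then show ?case using assms(1,4) rho_nz unfolding transfer_def
    by (metis (no_types, lifting) add.right_neutral cancel_comm_monoid_add_class.diff_cancel
        mult_eq_0_iff)
qed (use assms in auto)

text \<open>Cayley-Hamilton for T, which has trace t and determinant (1 - |eta|^2) / rho^2 = 1. The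
  two factors rho clear the denominators of two steps.\<close>

lemma transfer_recurrence:
  assumes "transfer c a (\<lambda>j. 0) (\<lambda>j. 0)"
  shows "c (Suc (Suc j)) = of_real t * c (Suc j) - c j" "a (Suc (Suc j)) = of_real t * a (Suc j) - a j"
proof -
  have r: "of_real \<rho> * c (Suc j) = z * c j - cnj \<eta> * a j" "of_real \<rho> * a (Suc j) = cnj z * a j - \<eta> * c j" for j
    using assms unfolding transfer_def by auto
  have "of_real \<rho> * (of_real \<rho> * (c (Suc (Suc j)) - (of_real t * c (Suc j) - c j))) = 0"
    using r[of j] r[of "Suc j"] eta_cnj z_cnj rho_t by algebra
  then show "c (Suc (Suc j)) = of_real t * c (Suc j) - c j"
    using rho_nz by simp
  have "of_real \<rho> * (of_real \<rho> * (a (Suc (Suc j)) - (of_real t * a (Suc j) - a j))) = 0"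
    using r[of j] r[of "Suc j"] eta_cnj z_cnj rho_t by algebra
  then show "a (Suc (Suc j)) = of_real t * a (Suc j) - a j"
    using rho_nz by simp
qed

lemma transfer_ell2_zero:
  assumes "transfer c a (\<lambda>j. 0) (\<lambda>j. 0)" "\<bar>t\<bar> \<le> 2" "c \<in> ell2" "a \<in> ell2"
  shows "c j = 0" "a j = 0"
  by (rule bounded_real_recurrence_zero[OF transfer_recurrence(1)[OF assms(1)] assms(2) ell2_tendsto_0[OF assms(3)]],
      rule bounded_real_recurrence_zero[OF transfer_recurrence(2)[OF assms(1)] assms(2) ell2_tendsto_0[OF assms(4)]])

text \<open>The formal eigenvector: the solution (d, cnj d) laid out along the indices of the
  matrix, whether or not it is square-summable.\<close>

definition h :: "nat \<Rightarrow> complex" where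
  "h n = (if even n then d (n div 2) else cnj (d (Suc (n div 2))))"

lemma h_even: "h (2 * j) = d j"
  and h_odd: "h (2 * j + 1) = cnj (d (Suc j))"
  by (simp_all add: h_def del: d.simps)

lemma h_odd_pred: "h (2 * j - 1) = cnj (d j)"
proof (cases j)
  case (Suc i)
  then show ?thesis using h_odd[of i] by simp
qed (simp add: h_def)

lemma h_ell2:
  assumes "d \<in> ell2"
  shows "h \<in> ell2"
proof (rule ell2_interleave)
  show "(\<lambda>j. h (2 * j + 1)) \<in> ell2"
    unfolding h_odd using assms ell2_cnj[of "\<lambda>j. d (Suc j)"] ell2_Suc[of d] by blast
qed (simp add: h_even assms)

text \<open>The boundary condition makes every homogeneous solution start at a multiple of (1, 1),
  so every eigenvector is a multiple of \<open>h\<close>.\<close>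

lemma point_spectrum_iff_d: "z \<in> point_spectrum (cmv_matrix \<eta> \<rho>) \<longleftrightarrow> d \<in> ell2"
proof
  assume "z \<in> point_spectrum (cmv_matrix \<eta> \<rho>)"
  then obtain u where u: "u \<in> ell2" "u \<noteq> (\<lambda>n. 0)" "mat_apply (cmv_matrix \<eta> \<rho>) u = (\<lambda>n. z * u n)"
    unfolding point_spectrum_def by blast
  define c a where "c = (\<lambda>j. u (2 * j))" and "a = (\<lambda>j. u (2 * j - 1))"
  have "(\<lambda>n. mat_apply (cmv_matrix \<eta> \<rho>) u n - z * u n) = (\<lambda>n. 0)"
    using u(3) by simp
  then have tr: "transfer c a (\<lambda>j. 0) (\<lambda>j. 0)"
    unfolding shifted_eq_iff_transfer c_def a_def .
  have "c j - c 0 * d j = 0 \<and> a j - c 0 * cnj (d j) = 0" for j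
    by (rule transfer_zero[OF transfer_diff_d[OF tr, of "c 0"], of 0]) (auto simp: c_def a_def)
  then have ca: "c j = c 0 * d j" "a j = c 0 * cnj (d j)" for j
    by (metis right_minus_eq)+
  have "c 0 \<noteq> 0"
  proof
    assume "c 0 = 0"
    then have 0: "u (2 * j) = 0" "u (2 * j - 1) = 0" for j
      using ca[of j] unfolding c_def a_def by auto
    have "u n = 0" for n
      using 0(1)[of "n div 2"] 0(2)[of "Suc (n div 2)"] by (cases "even n") auto
    with u(2) show False by auto
  qed
  have "c \<in> ell2" unfolding c_def using u(1) by (rule ell2_even)
  from ell2_mult[OF this, of "1 / c 0"] have "(\<lambda>j. 1 / c 0 * c j) \<in> ell2" .
  moreover have "(\<lambda>j. 1 / c 0 * c j) = d"
  proof
    fix j show "1 / c 0 * c j = d j"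
      using \<open>c 0 \<noteq> 0\<close> by (subst ca(1)) simp
  qed
  ultimately show "d \<in> ell2" by simp
next
  assume "d \<in> ell2"
  have "h \<noteq> (\<lambda>n. 0)"
    using h_even[of 0] by auto
  moreover have "(\<lambda>n. mat_apply (cmv_matrix \<eta> \<rho>) h n - z * h n) = (\<lambda>n. 0)"
    unfolding shifted_eq_iff_transfer h_even h_odd_pred by (rule transfer_d)
  then have "mat_apply (cmv_matrix \<eta> \<rho>) h = (\<lambda>n. z * h n)"
    by (simp add: fun_eq_iff)
  ultimately show "z \<in> point_spectrum (cmv_matrix \<eta> \<rho>)"
    unfolding point_spectrum_def using h_ell2[OF \<open>d \<in> ell2\<close>] by blast
qed

text \<open>(1, 1) is an eigenvector of T iff z - cnj eta is real; then d is geometric with ratio (z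
  - cnj eta) / rho, and square-summable iff this ratio is less than 1 in modulus.\<close>

lemma point_spectrum_iff:
  "z \<in> point_spectrum (cmv_matrix \<eta> \<rho>) \<longleftrightarrow> Im (z - cnj \<eta>) = 0 \<and> \<bar>Re (z - cnj \<eta>)\<bar> < \<rho>"
proof -
  have d1: "d (Suc 0) = (z - cnj \<eta>) / \<rho>" by simp
  have geo: "d j = (d (Suc 0)) ^ j" if "Im (z - cnj \<eta>) = 0" for j
  proof (induction j)
    case (Suc j)
    have "cnj (d (Suc 0)) = d (Suc 0)"
      using that unfolding d1 by (simp add: complex_eq_iff)
    then have "cnj (d j) = d j"
      unfolding Suc complex_cnj_power by (rule arg_cong)
    then have "of_real \<rho> * d (Suc j) = (z - cnj \<eta>) * d j"
      unfolding rho_d by (simp add: algebra_simps)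
    also have "z - cnj \<eta> = of_real \<rho> * d (Suc 0)"
      unfolding rho_d by simp
    finally have "of_real \<rho> * d (Suc j) = of_real \<rho> * (d (Suc 0) * d j)"
      by (simp only: mult.assoc)
    then have "d (Suc j) = d (Suc 0) * d j"
      using rho_nz mult_left_cancel by blast
    then show ?case
      unfolding power_Suc by (simp only: Suc)
  qed simp
  have cmod_d1: "cmod (d (Suc 0)) = \<bar>Re (z - cnj \<eta>)\<bar> / \<rho>" if "Im (z - cnj \<eta>) = 0"
    using that rho_pos unfolding d1 by (simp add: norm_divide cmod_eq_Re)
  show ?thesis
  proof
    assume "z \<in> point_spectrum (cmv_matrix \<eta> \<rho>)"
    then have d: "d \<in> ell2" by (simp add: point_spectrum_iff_d)
    note lim = ell2_tendsto_0[OF this]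
    \<comment> \<open>W is conserved because t is real, and its limit is 0 when d decays; at j = 0
      it is Im (z - cnj eta) / rho.\<close>
    define W where "W j = Im (d (Suc j) * cnj (d j))" for j
    have "W (Suc j) = W j" for j
      unfolding W_def transfer_recurrence(1)[OF transfer_d] by (simp add: algebra_simps del: d.simps)
    then have W: "W j = W 0" for j by (induction j) auto
    have "W \<longlonglongrightarrow> Im (0 * cnj 0)"
      unfolding W_def using LIMSEQ_Suc[OF lim] lim by (intro tendsto_intros)
    moreover have "W \<longlonglongrightarrow> W 0"
      by (intro tendsto_eventually always_eventually allI W)
    ultimately have "W 0 = Im (0 * cnj 0)"
      using LIMSEQ_unique by blast
    then have "W 0 = 0" by simp
    then have Im: "Im (z - cnj \<eta>) = 0"
      using rho_pos by (simp add: W_def Im_divide_of_real)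
    have "cmod (d (Suc 0)) < 1"
    proof (rule ccontr)
      assume "\<not> cmod (d (Suc 0)) < 1"
      then have "1 \<le> cmod (d j)" for j
        by (subst geo[OF Im]) (simp add: norm_power one_le_power del: d.simps)
      moreover have "(\<lambda>j. cmod (d j)) \<longlonglongrightarrow> 0"
        using lim by (rule tendsto_norm_zero)
      ultimately show False
        using LIMSEQ_le_const[of "\<lambda>j. cmod (d j)" 0 1] by auto
    qed
    then show "Im (z - cnj \<eta>) = 0 \<and> \<bar>Re (z - cnj \<eta>)\<bar> < \<rho>"
      using Im cmod_d1[OF Im] rho_pos by simp
  next
    assume *: "Im (z - cnj \<eta>) = 0 \<and> \<bar>Re (z - cnj \<eta>)\<bar> < \<rho>"
    then have "cmod (d (Suc 0)) < 1"
      using cmod_d1 rho_pos by simp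
    moreover have "d (Suc j) = d (Suc 0) * d j + 0" for j
      using geo[of "Suc j"] geo[of j] * by (simp only: power_Suc add_0_right)
    moreover have "(\<lambda>j. 0) \<in> ell2"
      by (rule ell2_finite_support) simp
    ultimately have "d \<in> ell2"
      by (rule ell2_forward_recursion[rotated 1, OF _ _])
    then show "z \<in> point_spectrum (cmv_matrix \<eta> \<rho>)"
      by (simp add: point_spectrum_iff_d)
  qed
qed

section \<open>Range of the shifted operator\<close>

text \<open>A preimage of the first unit vector solves the homogeneous recursion from index 1 on,
  and so vanishes there.\<close>

lemma shifted_range_neq_ell2:
  assumes "\<bar>t\<bar> \<le> 2"
  shows "shifted_range (cmv_matrix \<eta> \<rho>) z \<noteq> ell2"
proof
  define v :: "nat \<Rightarrow> complex" where "v n = (if n = 0 then 1 else 0)" for n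
  assume "shifted_range (cmv_matrix \<eta> \<rho>) z = ell2"
  moreover have "v \<in> ell2"
    by (rule ell2_finite_support[of 1]) (simp add: v_def)
  ultimately obtain c a where ca: "transfer c a (\<lambda>j. v (2 * j)) (\<lambda>j. v (2 * j + 1))" "c 0 = a 0"
    "c \<in> ell2" "a \<in> ell2"
    using shifted_rangeE by blast
  have "transfer (\<lambda>j. c (Suc j)) (\<lambda>j. a (Suc j)) (\<lambda>j. 0) (\<lambda>j. 0)"
    unfolding transfer_def
  proof
    fix j
    show "of_real \<rho> * c (Suc (Suc j)) = z * c (Suc j) - cnj \<eta> * a (Suc j) + 0 \<and>
      of_real \<rho> * a (Suc (Suc j)) =
        cnj z * a (Suc j) - \<eta> * c (Suc j) - cnj z * \<eta> * 0 - cnj z * of_real \<rho> * 0"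
      using ca(1)[unfolded transfer_def, rule_format, of "Suc j"] by (simp add: v_def)
  qed
  note zero = transfer_ell2_zero[OF this assms ell2_Suc[THEN iffD2, OF ca(3)] ell2_Suc[THEN iffD2, OF ca(4)]]
  have "c (Suc 0) = 0" "a (Suc 0) = 0"
    by (rule zero)+
  \<comment> \<open>With \<open>c 1 = a 1 = 0\<close>, row 1 forces \<open>a 0 = 0\<close>, hence
    \<open>c 0 = 0\<close>, and row 0 reads 0 = 1.\<close>
  moreover have "cnj \<eta> * a 0 + of_real \<rho> * c (Suc 0) - z * c 0 = 1 \<and>
      of_real \<rho> * a 0 - \<eta> * c (Suc 0) - z * a (Suc 0) = 0"
    unfolding transfer_step_iff using ca(1)[unfolded transfer_def, rule_format, of 0]
    by (simp add: v_def)
  ultimately show False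
    using ca(2) rho_nz by auto
qed

section \<open>Density of the range\<close>

lemma transfer_exists: "\<exists>c a. transfer c a f g \<and> c 0 = x \<and> a 0 = y"
proof -
  define p where "p = rec_nat (x, y) (\<lambda>j q.
    ((z * fst q - cnj \<eta> * snd q + f j) / of_real \<rho>,
     (cnj z * snd q - \<eta> * fst q - cnj z * \<eta> * f j - cnj z * of_real \<rho> * g j) / of_real \<rho>))"
  have "transfer (\<lambda>j. fst (p j)) (\<lambda>j. snd (p j)) f g"
    unfolding transfer_def using rho_pos by (simp add: p_def)
  moreover have "fst (p 0) = x" "snd (p 0) = y"
    by (simp_all add: p_def)
  ultimately show ?thesis by blast
qed

text \<open>As |eta| < 1 = |z|, the two terms of the recursion for d differ in modulus and cannot
  cancel.\<close>

lemma d_nz: "d j \<noteq> 0"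
proof (induction j)
  case (Suc j)
  have "\<bar>cmod \<eta>\<bar> < 1"
    using rho_sq rho_pos zero_less_power[of \<rho> 2] abs_square_less_1[of "cmod \<eta>"] by simp
  then have "cmod (cnj \<eta> * cnj (d j)) < cmod (z * d j)"
    using Suc z_circle by (simp add: norm_mult)
  then have "z * d j - cnj \<eta> * cnj (d j) \<noteq> 0"
    by auto
  then show ?case using rho_nz by simp
qed simp

text \<open>A discrete Green identity. The Wronskian with (d, cnj d) is 0 at the start by the
  boundary condition and would be conserved since det T = 1; each source term adds its pairing with
  \<open>h\<close>.\<close>

lemma transfer_wronskian:
  assumes "transfer c a (\<lambda>j. v (2 * j)) (\<lambda>j. v (2 * j + 1))" "c 0 = a 0"
  shows "cnj (d j) * c j - d j * a j = cnj z * (\<Sum>n<2 * j. cnj (h n) * v n)"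
proof (induction j)
  case 0
  then show ?case using assms(2) by simp
next
  case (Suc j)
  have r: "of_real \<rho> * c (Suc j) = z * c j - cnj \<eta> * a j + v (2 * j)"
    "of_real \<rho> * a (Suc j) = cnj z * a j - \<eta> * c j - cnj z * \<eta> * v (2 * j)
       - cnj z * of_real \<rho> * v (2 * j + 1)"
    using assms(1) unfolding transfer_def by auto
  have "(\<Sum>n<2 * Suc j. cnj (h n) * v n) = (\<Sum>n<2 * j. cnj (h n) * v n)
      + cnj (d j) * v (2 * j) + d (Suc j) * v (2 * j + 1)"
    using h_even[of j] h_odd[of j] by (simp del: d.simps)
  moreover have "of_real \<rho> * (of_real \<rho> * (cnj (d (Suc j)) * c (Suc j) - d (Suc j) * a (Suc j)
      - cnj z * ((\<Sum>n<2 * j. cnj (h n) * v n) + cnj (d j) * v (2 * j) + d (Suc j) * v (2 * j + 1)))) = 0"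
    using r rho_d[of j] rho_cnj_d[of j] eta_cnj z_cnj Suc by algebra
  ultimately show ?case using rho_nz by simp
qed

text \<open>Past the support of v the Wronskian vanishes, so the solution is a multiple of the formal
  eigenvector h there and can be cut off by subtracting that multiple.\<close>

lemma orthogonal_in_shifted_range:
  assumes supp: "\<And>n. n \<ge> 2 * N \<Longrightarrow> v n = 0" and orth: "(\<Sum>n<2 * N. cnj (h n) * v n) = 0"
  shows "v \<in> shifted_range (cmv_matrix \<eta> \<rho>) z"
proof -
  obtain c a where tr: "transfer c a (\<lambda>j. v (2 * j)) (\<lambda>j. v (2 * j + 1))" and 0: "c 0 = 0" "a 0 = 0"
    using transfer_exists by blast
  define k where "k = c N / d N"
  note tr' = transfer_diff_d[OF tr, of k]
  have "cnj (d N) * c N = d N * a N"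
    using transfer_wronskian[OF tr, of N] 0 orth by simp
  then have cN: "c N - k * d N = 0" "a N - k * cnj (d N) = 0"
    using d_nz[of N] by (simp_all add: k_def field_simps)
  have van: "c j - k * d j = 0 \<and> a j - k * cnj (d j) = 0" if "j \<ge> N" for j
    using transfer_zero[OF tr' cN _ that] supp by simp
  \<comment> \<open>The corrected solution starts at -k in both components, since \<open>d 0\<close>
    is 1, so the boundary condition survives.\<close>
  show ?thesis
    by (rule transfer_imp_shifted_range[OF tr'])
      (use 0 van in \<open>auto intro!: ell2_finite_support[of N]\<close>)
qed

lemma shifted_range_dense:
  assumes d: "d \<notin> ell2" and v: "v \<in> ell2" and "e > 0"
  shows "\<exists>w\<in>shifted_range (cmv_matrix \<eta> \<rho>) z. ell2_norm (\<lambda>n. v n - w n) < e"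
proof -
  \<comment> \<open>The error is split as x + y with both squared norms below this bound; |x + y|^2
    \<le> 2 |x|^2 + 2 |y|^2 then gives a total below e^2.\<close>
  define \<epsilon> where "\<epsilon> = e\<^sup>2 / 4"
  have "\<epsilon> > 0" using \<open>e > 0\<close> by (simp add: \<epsilon>_def)
  let ?sq = "\<lambda>u n. (cmod (u n))\<^sup>2"
  obtain N where N: "\<And>n. n \<ge> N \<Longrightarrow> norm (\<Sum>i. ?sq v (i + n)) < \<epsilon>"
    using suminf_exist_split[OF \<open>\<epsilon> > 0\<close>, of "?sq v"] v by (auto simp: ell2_def)
  define I where "I = (\<Sum>n<2 * N. cnj (h n) * v n)"
  have "h \<notin> ell2"
    using d ell2_even[of h] by (auto simp: h_even)
  \<comment> \<open>As \<open>h\<close> is not in l2, its partial square sums exceed any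
    bound.\<close>
  then obtain n where n: "(\<Sum>j<n. ?sq h j) > (cmod I)\<^sup>2 / \<epsilon>"
    using ell2_bounded_partial_sums[of h "(cmod I)\<^sup>2 / \<epsilon>"] by (meson not_le)
  define K where "K = max n N"
  define H where "H = (\<Sum>j<2 * K. ?sq h j)"
  have "(\<Sum>j<n. ?sq h j) \<le> H"
    unfolding H_def K_def by (intro sum_mono2) auto
  with n have H: "(cmod I)\<^sup>2 / \<epsilon> < H" by linarith
  then have "H > 0"
    using \<open>\<epsilon> > 0\<close> by (smt (verit) divide_nonneg_pos zero_le_power2)
  have IH: "(cmod I)\<^sup>2 / H < \<epsilon>"
    using H \<open>H > 0\<close> \<open>\<epsilon> > 0\<close> by (simp add: field_simps)
  \<comment> \<open>x is the tail of v. y is the orthogonal projection of the rest onto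
    \<open>h\<close> truncated at 2 K; its squared norm |I|^2 / H is small because H is
    large.\<close>
  define x where "x n = (if n < 2 * N then 0 else v n)" for n
  define y where "y n = (if n < 2 * K then I / of_real H * h n else 0)" for n
  define w where "w n = v n - x n - y n" for n
  have "w \<in> shifted_range (cmv_matrix \<eta> \<rho>) z"
  proof (rule orthogonal_in_shifted_range[of K])
    show "w n = 0" if "2 * K \<le> n" for n
      using that by (simp add: w_def x_def y_def K_def)
    have "(\<Sum>n<2 * K. cnj (h n) * w n)
        = (\<Sum>n<2 * K. cnj (h n) * (v n - x n)) - (\<Sum>n<2 * K. cnj (h n) * y n)"
      unfolding w_def right_diff_distrib sum_subtractf ..
    also have "(\<Sum>n<2 * K. cnj (h n) * (v n - x n)) = I"
      unfolding I_def by (rule sum.mono_neutral_cong_right) (auto simp: x_def K_def)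
    also have "(\<Sum>n<2 * K. cnj (h n) * y n) = (\<Sum>n<2 * K. I / of_real H * of_real (?sq h n))"
      by (intro sum.cong) (simp_all add: y_def complex_norm_square mult_ac del: of_real_power)
    also have "\<dots> = I / of_real H * of_real H"
      by (subst (2) H_def) (simp only: of_real_sum sum_distrib_left)
    also have "\<dots> = I"
      using \<open>H > 0\<close> by simp
    finally show "(\<Sum>n<2 * K. cnj (h n) * w n) = 0" by simp
  qed
  moreover have "ell2_norm (\<lambda>n. v n - w n) < e"
  proof -
    have x: "?sq x sums (\<Sum>i. ?sq v (i + 2 * N))"
    proof -
      have "(\<lambda>i. ?sq x (i + 2 * N)) sums (\<Sum>i. ?sq v (i + 2 * N))"
        using summable_sums[OF summable_ignore_initial_segment[of "?sq v" "2 * N"]] v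
        by (simp add: x_def ell2_def)
      then have "?sq x sums ((\<Sum>i. ?sq v (i + 2 * N)) + (\<Sum>i<2 * N. ?sq x i))"
        by (rule sums_iff_shift[THEN iffD1])
      also have "(\<Sum>i<2 * N. ?sq x i) = 0"
        by (rule sum.neutral) (simp add: x_def)
      finally show ?thesis by simp
    qed
    have y: "?sq y sums ((cmod I)\<^sup>2 / H)"
    proof -
      have "?sq y sums (\<Sum>n<2 * K. ?sq y n)"
        by (rule sums_finite) (auto simp: y_def)
      also have "(\<Sum>n<2 * K. ?sq y n) = (\<Sum>n<2 * K. (cmod I / H)\<^sup>2 * ?sq h n)"
        using \<open>H > 0\<close> by (intro sum.cong) (auto simp: y_def norm_mult norm_divide power_mult_distrib power_divide)
      also have "\<dots> = (cmod I / H)\<^sup>2 * H"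
        by (subst (2) H_def) (simp only: sum_distrib_left)
      also have "\<dots> = (cmod I)\<^sup>2 / H"
        using \<open>H > 0\<close> by (simp add: power2_eq_square)
      finally show ?thesis .
    qed
    have xy: "(\<lambda>n. 2 * ?sq x n + 2 * ?sq y n) sums (2 * (\<Sum>i. ?sq v (i + 2 * N)) + 2 * ((cmod I)\<^sup>2 / H))"
      by (intro sums_add sums_mult x y)
    have le: "(cmod (v n - w n))\<^sup>2 \<le> 2 * ?sq x n + 2 * ?sq y n" for n
      using cmod_add_sq_le[of "x n" "y n"] by (simp add: w_def)
    have "norm ((cmod (v n - w n))\<^sup>2) \<le> 2 * ?sq x n + 2 * ?sq y n" for n
      using le[of n] by simp
    then have "summable (\<lambda>n. (cmod (v n - w n))\<^sup>2)"
      by (rule summable_comparison_test'[OF sums_summable[OF xy], of 0])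
    then have "(\<Sum>n. (cmod (v n - w n))\<^sup>2) \<le> (\<Sum>n. 2 * ?sq x n + 2 * ?sq y n)"
      by (intro suminf_le le sums_summable[OF xy])
    also have "\<dots> = 2 * (\<Sum>i. ?sq v (i + 2 * N)) + 2 * ((cmod I)\<^sup>2 / H)"
      by (rule sums_unique[OF xy, symmetric])
    also have "\<dots> < e\<^sup>2"
    proof -
      have "\<bar>\<Sum>i. ?sq v (i + 2 * N)\<bar> < \<epsilon>"
        using N[of "2 * N"] by simp
      then show ?thesis using IH unfolding \<epsilon>_def by linarith
    qed
    finally have "ell2_norm (\<lambda>n. v n - w n) < sqrt (e\<^sup>2)"
      unfolding ell2_norm_def by (rule real_sqrt_less_mono)
    then show ?thesis using \<open>e > 0\<close> by simp
  qed
  ultimately show ?thesis by blast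
qed

section \<open>Surjectivity in the hyperbolic case\<close>

text \<open>l is the smaller root of l^2 - t l + 1, whose roots have product 1. It is computed for
  |t| and then given the sign of t.\<close>

lemma hyperbolic_multiplier:
  assumes "\<bar>t\<bar> > 2"
  obtains l :: real where "l \<noteq> 0" "\<bar>l\<bar> < 1" "l * t = l\<^sup>2 + 1"
proof -
  define s where "s = sqrt (t\<^sup>2 - 4)"
  have "2\<^sup>2 < \<bar>t\<bar>\<^sup>2" using assms by (intro power_strict_mono) auto
  then have s2: "s\<^sup>2 = \<bar>t\<bar>\<^sup>2 - 4" and "s > 0" by (simp_all add: s_def)
  have "s < \<bar>t\<bar>"
    by (rule power2_less_imp_less) (use s2 in auto)
  moreover have "\<bar>t\<bar> - 2 < s"
    by (rule power2_less_imp_less) (use s2 assms \<open>s > 0\<close> in \<open>auto simp: power2_diff\<close>)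
  ultimately have k: "(\<bar>t\<bar> - s) / 2 > 0" "(\<bar>t\<bar> - s) / 2 < 1" by auto
  have eq: "(\<bar>t\<bar> - s) / 2 * \<bar>t\<bar> = ((\<bar>t\<bar> - s) / 2)\<^sup>2 + 1"
    using s2 by (simp add: field_simps power2_eq_square)
  show thesis
  proof (cases "t > 0")
    case True
    then show thesis using that[of "(\<bar>t\<bar> - s) / 2"] k eq by simp
  next
    case False
    then show thesis using that[of "- ((\<bar>t\<bar> - s) / 2)"] k eq by (simp add: power2_eq_square)
  qed
qed

text \<open>The left eigenvectors (eta, z - m) of the transfer matrix decouple the recursion. The
  contracting component is solved forwards, the expanding one backwards; the boundary condition
  then fixes the initial value of the former unless the latter vanishes on (1, 1), that is, unless z
  is an eigenvalue.\<close>

lemma ell2_subset_shifted_range: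
  assumes t: "\<bar>t\<bar> > 2" and np: "z \<notin> point_spectrum (cmv_matrix \<eta> \<rho>)"
  shows "ell2 \<subseteq> shifted_range (cmv_matrix \<eta> \<rho>) z"
proof
  fix v :: "nat \<Rightarrow> complex" assume v: "v \<in> ell2"
  obtain l :: real where l: "l \<noteq> 0" "\<bar>l\<bar> < 1" "l * t = l\<^sup>2 + 1"
    using hyperbolic_multiplier[OF t] .
  have "2 * Re z = \<rho> * t" using rho_pos by (simp add: t_def)
  then have trace: "\<rho> * l + \<rho> / l = 2 * Re z"
    using l by (simp add: field_simps power2_eq_square)
  \<comment> \<open>The eigenvalues of rho T, contracting and expanding when compared with
    rho.\<close>
  define m1 m2 where "m1 = complex_of_real (\<rho> * l)" and "m2 = complex_of_real (\<rho> / l)"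
  have m: "m1 * m2 = of_real \<rho> * of_real \<rho>" "m1 + m2 = z + cnj z" "m1 = of_real \<rho> * of_real l"
    "of_real l * m2 = of_real \<rho>"
  proof -
    show "m1 * m2 = of_real \<rho> * of_real \<rho>"
      unfolding m1_def m2_def of_real_mult[symmetric] using l(1) by simp
    show "m1 + m2 = z + cnj z"
      unfolding m1_def m2_def of_real_add[symmetric] trace complex_add_cnj ..
    show "m1 = of_real \<rho> * of_real l"
      unfolding m1_def of_real_mult ..
    show "of_real l * m2 = of_real \<rho>"
      unfolding m2_def of_real_mult[symmetric] using l(1) by simp
  qed
  have "l * l \<noteq> 1" using l(2) abs_square_less_1[of l] by (simp add: power2_eq_square)
  then have "\<rho> / l \<noteq> \<rho> * l"
    using l(1) rho_pos by (simp add: field_simps)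
  then have "m2 - m1 \<noteq> 0"
    unfolding m1_def m2_def by (simp only: right_minus_eq of_real_eq_iff not_False_eq_True)
  \<comment> \<open>Needed to recover c from the components; eta = 0 would give rho = 1 and |t| = 2
    |Re z| \<le> 2.\<close>
  have "\<eta> \<noteq> 0"
  proof
    assume "\<eta> = 0"
    then have "\<rho> = 1" using rho_sq rho_pos by (simp add: power2_eq_1_iff)
    then show False using t[unfolded t_def] abs_Re_le_cmod[of z] z_circle by simp
  qed
  \<comment> \<open>The value of the expanding left eigenvector on (1, 1). Were it 0, the trace
    relation would give z - cnj eta = m1 and make z an eigenvalue.\<close>
  have q1: "\<eta> + z - m2 \<noteq> 0"
  proof
    assume "\<eta> + z - m2 = 0"
    then have "Im \<eta> + Im z = 0" "Re \<eta> + Re z = \<rho> / l"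
      unfolding m2_def by (simp_all add: complex_eq_iff)
    then have "Im (z - cnj \<eta>) = 0" "Re (z - cnj \<eta>) = \<rho> * l"
      using trace by simp_all
    moreover have "\<bar>\<rho> * l\<bar> < \<rho>"
      using rho_pos l(2) by (simp add: abs_mult)
    ultimately show False
      using np by (simp add: point_spectrum_iff)
  qed
  define f g where "f = (\<lambda>j. v (2 * j))" and "g = (\<lambda>j. v (2 * j + 1))"
  have fg: "f \<in> ell2" "g \<in> ell2"
    unfolding f_def g_def using v ell2_even ell2_odd by blast+
  \<comment> \<open>The source seen by the component eta c + (z - m) a, after division by
    rho.\<close>
  define G where "G m j = 1 / of_real \<rho> * (\<eta> * f j - (z - m) * (cnj z * (\<eta> * f j + of_real \<rho> * g j)))" for m j
  have G: "(\<lambda>j. G m j) \<in> ell2" for m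
    unfolding G_def by (intro ell2_mult ell2_diff ell2_add fg)
  have rho_G: "of_real \<rho> * G m j = \<eta> * f j - (z - m) * (cnj z * (\<eta> * f j + of_real \<rho> * g j))" for m j
    using rho_nz by (simp add: G_def)
  \<comment> \<open>The expanding recursion Q (j + 1) = Q j / l + G m2 j, solved for Q j.\<close>
  obtain Q where Q: "Q \<in> ell2" "\<And>j. Q j = of_real l * Q (Suc j) + (- of_real l) * G m2 j"
    using ell2_backward_recursion[OF ell2_mult[OF G[of m2], of "- of_real l"], of "of_real l"] l by auto
  \<comment> \<open>The common value of \<open>c 0\<close> and \<open>a 0\<close>, forced by Q 0 =
    (eta + z - m2) x; P is started accordingly.\<close>
  define x where "x = Q 0 / (\<eta> + z - m2)"
  define P where "P = rec_nat ((\<eta> + z - m1) * x) (\<lambda>j p. of_real l * p + G m1 j)"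
  have P: "P 0 = (\<eta> + z - m1) * x" "P (Suc j) = of_real l * P j + G m1 j" for j
    by (simp_all add: P_def)
  have "P \<in> ell2"
    by (rule ell2_forward_recursion[OF G[of m1] _ P(2)]) (use l in simp)
  \<comment> \<open>a and c solve P = eta c + (z - m1) a and Q = eta c + (z - m2) a.\<close>
  define a where "a j = 1 / (m2 - m1) * (P j - Q j)" for j
  define c where "c j = 1 / \<eta> * (P j - (z - m1) * a j)" for j
  have "a \<in> ell2"
    unfolding a_def by (intro ell2_mult ell2_diff \<open>P \<in> ell2\<close> Q(1))
  then have "c \<in> ell2"
    unfolding c_def by (intro ell2_mult ell2_diff \<open>P \<in> ell2\<close>)
  have a: "(m2 - m1) * a j = P j - Q j" for j
    using \<open>m2 - m1 \<noteq> 0\<close> by (simp add: a_def)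
  have c: "\<eta> * c j = P j - (z - m1) * a j" for j
    using \<open>\<eta> \<noteq> 0\<close> by (simp add: c_def)
  have P': "of_real \<rho> * P (Suc j) = m1 * P j + of_real \<rho> * G m1 j" for j
    unfolding P(2) m(3) by (simp add: algebra_simps)
  have Q': "of_real \<rho> * Q (Suc j) = m2 * Q j + of_real \<rho> * G m2 j" for j
    by (subst (2) Q(2)) (simp add: algebra_simps flip: m(4))
  have "transfer c a f g"
    unfolding transfer_def
  proof (intro allI conjI)
    fix j
    have "(m2 - m1) * (of_real \<rho> * a (Suc j)
        - (cnj z * a j - \<eta> * c j - cnj z * \<eta> * f j - cnj z * of_real \<rho> * g j)) = 0"
      using a[of j] a[of "Suc j"] c[of j] P'[of j] Q'[of j] m(1,2) rho_G[of m1 j] rho_G[of m2 j] z_cnj eta_cnj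
      by algebra
    then show a': "of_real \<rho> * a (Suc j)
        = cnj z * a j - \<eta> * c j - cnj z * \<eta> * f j - cnj z * of_real \<rho> * g j"
      using \<open>m2 - m1 \<noteq> 0\<close> by simp
    have "\<eta> * (of_real \<rho> * c (Suc j) - (z * c j - cnj \<eta> * a j + f j)) = 0"
      using a' c[of j] c[of "Suc j"] P'[of j] m(1,2) rho_G[of m1 j] z_cnj eta_cnj
      by algebra
    then show "of_real \<rho> * c (Suc j) = z * c j - cnj \<eta> * a j + f j"
      using \<open>\<eta> \<noteq> 0\<close> by simp
  qed
  moreover have "c 0 = a 0"
  proof -
    have Q0: "Q 0 = (\<eta> + z - m2) * x"
      using q1 by (simp add: x_def)
    have "(m2 - m1) * a 0 = (m2 - m1) * x"
      unfolding a P(1) Q0 by (simp add: algebra_simps)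
    then have a0: "a 0 = x" using \<open>m2 - m1 \<noteq> 0\<close> by simp
    have "\<eta> * c 0 = \<eta> * a 0"
      unfolding c P(1) a0 by (simp add: algebra_simps)
    then show ?thesis using \<open>\<eta> \<noteq> 0\<close> by simp
  qed
  ultimately show "v \<in> shifted_range (cmv_matrix \<eta> \<rho>) z"
    using transfer_imp_shifted_range \<open>c \<in> ell2\<close> \<open>a \<in> ell2\<close> unfolding f_def g_def by blast
qed

text \<open>For |t| \<le> 2 the shifted operator is injective with dense range but not onto; for |t|
  > 2 either z is an eigenvalue or the operator is onto.\<close>

lemma continuous_spectrum_iff:
  "z \<in> continuous_spectrum (cmv_matrix \<eta> \<rho>) \<longleftrightarrow> \<bar>Re z\<bar> \<le> \<rho>"
proof -
  have t: "\<bar>t\<bar> \<le> 2 \<longleftrightarrow> \<bar>Re z\<bar> \<le> \<rho>"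
    using rho_pos by (simp add: t_def abs_mult field_simps)
  show ?thesis
  proof (cases "\<bar>t\<bar> \<le> 2")
    case True
    have "d \<notin> ell2"
      using transfer_ell2_zero(1)[OF transfer_d True, of 0] ell2_cnj[of d] by auto
    then have "z \<in> continuous_spectrum (cmv_matrix \<eta> \<rho>)"
      unfolding continuous_spectrum_def mem_Collect_eq
      using shifted_range_neq_ell2[OF True] shifted_range_dense point_spectrum_iff_d by blast
    then show ?thesis using t True by simp
  next
    case False
    then have "z \<notin> continuous_spectrum (cmv_matrix \<eta> \<rho>)"
      unfolding continuous_spectrum_def
      using ell2_subset_shifted_range shifted_range_cmv_subset[of \<eta> \<rho> z] by auto
    then show ?thesis using t False by simp
  qed
qed

end
section \<open>Angles\<close>

text \<open>Monotonicity of cos on [0, pi], applied at x and at pi - x.\<close>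

lemma abs_cos_le_iff_0_pi:
  assumes "0 \<le> r" "r \<le> 1" "0 \<le> x" "x \<le> pi"
  shows "\<bar>cos x\<bar> \<le> r \<longleftrightarrow> x \<in> {arccos r..pi - arccos r}"
proof -
  have r: "cos (arccos r) = r" "0 \<le> arccos r" "arccos r \<le> pi"
    using assms by (simp_all add: arccos_lbound arccos_ubound)
  have "cos x \<le> r \<longleftrightarrow> arccos r \<le> x"
    using cos_mono_le_eq[of x "arccos r"] r assms by simp
  moreover have "- cos x \<le> r \<longleftrightarrow> x \<le> pi - arccos r"
    using cos_mono_le_eq[of "pi - x" "arccos r"] r assms by auto
  ultimately show ?thesis by (auto simp: abs_le_iff)
qed

lemma abs_cos_le_iff:
  assumes "0 \<le> r" "r \<le> 1"
  shows "\<bar>cos x\<bar> \<le> r \<longleftrightarrow> (\<exists>y n. x = y + 2 * pi * of_int n \<and>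
    y \<in> {arccos r..pi - arccos r} \<union> {pi + arccos r..2 * pi - arccos r})"
    (is "_ \<longleftrightarrow> (\<exists>y n. _ \<and> y \<in> ?A)")
proof -
  have per: "cos (y + 2 * pi * of_int n) = cos y" for y and n :: int
    by (simp add: cos_add)
  have arc: "0 \<le> arccos r"
    using assms by (simp add: arccos_lbound)
  have A: "\<bar>cos y\<bar> \<le> r \<longleftrightarrow> y \<in> ?A" if "0 \<le> y" "y < 2 * pi" for y
  proof (cases "y \<le> pi")
    case True
    have "y \<notin> {pi + arccos r..2 * pi - arccos r}" if "y \<notin> {arccos r..pi - arccos r}"
      using that True arc by auto
    then show ?thesis using abs_cos_le_iff_0_pi[OF assms \<open>0 \<le> y\<close> True] by auto
  next
    case False
    then have "\<bar>cos y\<bar> \<le> r \<longleftrightarrow> y - pi \<in> {arccos r..pi - arccos r}"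
      using abs_cos_le_iff_0_pi[OF assms, of "y - pi"] that by (simp add: cos_diff)
    then show ?thesis using False arc by auto
  qed
  show ?thesis
  proof
    assume x: "\<bar>cos x\<bar> \<le> r"
    define n where "n = \<lfloor>x / (2 * pi)\<rfloor>"
    define y where "y = x - 2 * pi * of_int n"
    have "of_int n \<le> x / (2 * pi)" "x / (2 * pi) < of_int n + 1"
      unfolding n_def by linarith+
    then have "0 \<le> y" "y < 2 * pi"
      by (simp_all add: y_def field_simps)
    moreover have "x = y + 2 * pi * of_int n" by (simp add: y_def)
    moreover from this x have "\<bar>cos y\<bar> \<le> r" by (simp only: per)
    ultimately show "\<exists>y n. x = y + 2 * pi * of_int n \<and> y \<in> ?A"
      using A by blast
  next
    assume "\<exists>y n. x = y + 2 * pi * of_int n \<and> y \<in> ?A"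
    then obtain y n where y: "x = y + 2 * pi * of_int n" "y \<in> ?A" by blast
    then have "0 \<le> y" "y \<le> 2 * pi" using arc pi_gt_zero by auto
    \<comment> \<open>The endpoint 2 pi lies outside the half-open period and belongs to the set
      only when arccos r = 0, that is, r = 1.\<close>
    have "\<bar>cos y\<bar> \<le> r"
    proof (cases "y = 2 * pi")
      case True
      then have "arccos r = 0" using y(2) arc pi_gt_zero by auto
      then have "cos 0 = r" using assms cos_arccos[of r] by simp
      then show ?thesis using True by simp
    next
      case False
      then show ?thesis using A[of y] y(2) \<open>0 \<le> y\<close> \<open>y \<le> 2 * pi\<close> by simp
    qed
    then show "\<bar>cos x\<bar> \<le> r" using y(1) by (simp only: per)
  qed
qed

section \<open>The eigenvalue condition in terms of angles\<close>

text \<open>Here z = x + i y and eta = R + i S. If y = -S, the inequality squares to R^2 < R x; as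
  |R| < |x| holds anyway, this says that R is nonzero and has the sign of x.\<close>

lemma edge_angle_iff:
  fixes x y R S :: real
  assumes "x\<^sup>2 + y\<^sup>2 = 1" "R\<^sup>2 + S\<^sup>2 < 1"
  shows "y + S = 0 \<and> \<bar>x - R\<bar> < sqrt (1 - (R\<^sup>2 + S\<^sup>2)) \<longleftrightarrow>
    R \<noteq> 0 \<and> y = - S \<and> x = (if 0 \<le> R then sqrt (1 - S\<^sup>2) else - sqrt (1 - S\<^sup>2))"
proof (cases "y = - S")
  case True
  then have x: "1 - S\<^sup>2 = x\<^sup>2" using assms(1) by simp
  then have Rx: "\<bar>R\<bar> < \<bar>x\<bar>"
    using assms(2) abs_le_square_iff[of x R] by linarith
  have "\<bar>x - R\<bar> < sqrt (1 - (R\<^sup>2 + S\<^sup>2)) \<longleftrightarrow> sqrt ((x - R)\<^sup>2) < sqrt (x\<^sup>2 - R\<^sup>2)"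
    unfolding x[symmetric] by (simp add: diff_diff_eq add.commute)
  also have "\<dots> \<longleftrightarrow> R * R < R * x"
    unfolding real_sqrt_less_iff by (auto simp: power2_eq_square algebra_simps)
  also have "\<dots> \<longleftrightarrow> R > 0 \<and> R < x \<or> R < 0 \<and> x < R"
    unfolding mult_less_cancel_left by auto
  also have "\<dots> \<longleftrightarrow> R \<noteq> 0 \<and> x = (if 0 \<le> R then \<bar>x\<bar> else - \<bar>x\<bar>)"
    using Rx by auto
  finally show ?thesis
    using True by (simp add: x)
qed auto

text \<open>The case split in \<open>theta_0\<close> is on the sign of Re eta: arcsin has
  nonnegative cosine, and pi - arcsin reverses it while keeping the sine.\<close>

lemma cos_theta_0:
  assumes "k \<in> momenta \<alpha> \<beta>"
  shows "cos (theta_0 \<alpha> \<beta> k) = (if 0 \<le> Re (eta \<alpha> \<beta> k) then sqrt (1 - (Im (eta \<alpha> \<beta> k))\<^sup>2)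
      else - sqrt (1 - (Im (eta \<alpha> \<beta> k))\<^sup>2))"
    and sin_theta_0: "sin (theta_0 \<alpha> \<beta> k) = - Im (eta \<alpha> \<beta> k)"
proof -
  have "\<bar>Im (eta \<alpha> \<beta> k)\<bar> \<le> 1"
    using assms abs_Im_le_cmod[of "eta \<alpha> \<beta> k"] by (simp add: momenta_def)
  then have "\<bar>sin k * sin (\<alpha> - \<beta>)\<bar> \<le> 1" by (simp add: eta_def)
  then have S: "- 1 \<le> - sin k * sin (\<alpha> - \<beta>)" "- sin k * sin (\<alpha> - \<beta>) \<le> 1"
    by (simp_all add: abs_le_iff)
  show "cos (theta_0 \<alpha> \<beta> k) = (if 0 \<le> Re (eta \<alpha> \<beta> k) then sqrt (1 - (Im (eta \<alpha> \<beta> k))\<^sup>2)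
      else - sqrt (1 - (Im (eta \<alpha> \<beta> k))\<^sup>2))"
    using cos_arcsin[OF S] by (simp add: theta_0_def eta_def cos_diff)
  show "sin (theta_0 \<alpha> \<beta> k) = - Im (eta \<alpha> \<beta> k)"
    using sin_arcsin[OF S] by (simp add: theta_0_def eta_def sin_diff)
qed

lemma cos_eq_0_period_iff:
  assumes "k \<in> {0..<2 * pi}"
  shows "cos k = 0 \<longleftrightarrow> k = pi / 2 \<or> k = 3 * pi / 2"
proof
  assume "cos k = 0"
  then obtain i :: int where i: "odd i" "k = of_int i * (pi / 2)"
    unfolding cos_zero_iff_int by blast
  \<comment> \<open>Comparing multiples of pi / 2 confines the odd integer i to 0 \<le> i <
    4.\<close>
  have "0 * (pi / 2) \<le> of_int i * (pi / 2)" "of_int i * (pi / 2) < 4 * (pi / 2)"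
    using assms i(2) by auto
  then have "0 \<le> real_of_int i" "real_of_int i < 4"
    unfolding mult_le_cancel_right mult_less_cancel_right using pi_gt_zero by auto
  then have "0 \<le> i" "i < 4" by simp_all
  then have "i = 1 \<or> i = 3" using i(1) by presburger
  then show "k = pi / 2 \<or> k = 3 * pi / 2" using i(2) by auto
next
  have "3 * pi / 2 = 3 / 2 * pi" by simp
  then have "cos (3 * pi / 2) = 0" by (simp only: cos_3over2_pi)
  moreover assume "k = pi / 2 \<or> k = 3 * pi / 2"
  ultimately show "cos k = 0" by (metis cos_pi_half)
qed

section \<open>Bulk and edge\<close>

lemma cmv_circle_cis:
  assumes "k \<in> momenta \<alpha> \<beta>"
  shows "cmv_circle (eta \<alpha> \<beta> k) (cis \<theta>) (rho \<alpha> \<beta> k)"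
proof
  have "(cmod (eta \<alpha> \<beta> k))\<^sup>2 < 1"
    using assms by (simp add: momenta_def abs_square_less_1)
  then show "0 < rho \<alpha> \<beta> k" "(rho \<alpha> \<beta> k)\<^sup>2 = 1 - (cmod (eta \<alpha> \<beta> k))\<^sup>2"
    by (simp_all add: rho_def)
qed simp

lemma continuous_spectrum_cmv_iff:
  assumes "k \<in> momenta \<alpha> \<beta>"
  shows "cis \<theta> \<in> continuous_spectrum (cmv \<alpha> \<beta> k) \<longleftrightarrow> (\<exists>\<phi> n. \<theta> = \<phi> + 2 * pi * of_int n \<and>
    \<phi> \<in> {theta_c \<alpha> \<beta> k..pi - theta_c \<alpha> \<beta> k} \<union> {pi + theta_c \<alpha> \<beta> k..2 * pi - theta_c \<alpha> \<beta> k})"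
proof -
  interpret cmv_circle "eta \<alpha> \<beta> k" "cis \<theta>" "rho \<alpha> \<beta> k"
    using assms by (rule cmv_circle_cis)
  have "rho \<alpha> \<beta> k \<le> 1" by (simp add: rho_def)
  then show ?thesis
    unfolding cmv_def continuous_spectrum_iff theta_c_def
    using abs_cos_le_iff[of "rho \<alpha> \<beta> k" \<theta>] rho_pos by simp
qed

lemma point_spectrum_cmv_iff:
  assumes "k \<in> momenta \<alpha> \<beta>"
  shows "cis \<theta> \<in> point_spectrum (cmv \<alpha> \<beta> k) \<longleftrightarrow>
    sin (\<alpha> + \<beta>) \<noteq> 0 \<and> k \<notin> {pi / 2, 3 * pi / 2} \<and> (\<exists>n::int. \<theta> = theta_0 \<alpha> \<beta> k + 2 * pi * n)"
proof -
  let ?R = "Re (eta \<alpha> \<beta> k)" and ?S = "Im (eta \<alpha> \<beta> k)"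
  interpret cmv_circle "eta \<alpha> \<beta> k" "cis \<theta>" "rho \<alpha> \<beta> k"
    using assms by (rule cmv_circle_cis)
  have "(cmod (eta \<alpha> \<beta> k))\<^sup>2 < 1"
    using assms by (simp add: momenta_def abs_square_less_1)
  then have RS: "?R\<^sup>2 + ?S\<^sup>2 < 1" by (simp only: cmod_power2)
  have "cis \<theta> \<in> point_spectrum (cmv \<alpha> \<beta> k) \<longleftrightarrow>
      sin \<theta> + ?S = 0 \<and> \<bar>cos \<theta> - ?R\<bar> < sqrt (1 - (?R\<^sup>2 + ?S\<^sup>2))"
    unfolding cmv_def point_spectrum_iff by (simp add: rho_def cmod_power2)
  also have "\<dots> \<longleftrightarrow> ?R \<noteq> 0 \<and> sin \<theta> = sin (theta_0 \<alpha> \<beta> k) \<and> cos \<theta> = cos (theta_0 \<alpha> \<beta> k)"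
    unfolding cos_theta_0[OF assms] sin_theta_0[OF assms] by (rule edge_angle_iff) (use RS in simp_all)
  also have "\<dots> \<longleftrightarrow> ?R \<noteq> 0 \<and> (\<exists>n::int. \<theta> = theta_0 \<alpha> \<beta> k + 2 * pi * n)"
    unfolding sin_cos_eq_iff ..
  \<comment> \<open>Re eta = - cos k sin (\<alpha> + \<beta>), so both exceptions of the edge
    formula are zeros of Re eta.\<close>
  also have "?R \<noteq> 0 \<longleftrightarrow> sin (\<alpha> + \<beta>) \<noteq> 0 \<and> k \<notin> {pi / 2, 3 * pi / 2}"
    using cos_eq_0_period_iff[of k] assms by (auto simp: momenta_def eta_def)
  finally show ?thesis by blast
qed

theorem theorem2:
  fixes \<alpha> \<beta> :: real
  assumes "\<alpha> \<in> {0..<2 * pi}" and "\<beta> \<in> {0..<2 * pi}"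
  shows "Bulk \<alpha> \<beta> = mod_2pi (\<Union>k\<in>momenta \<alpha> \<beta>.
           {k} \<times> ({theta_c \<alpha> \<beta> k..pi - theta_c \<alpha> \<beta> k} \<union>
                  {pi + theta_c \<alpha> \<beta> k..2 * pi - theta_c \<alpha> \<beta> k}))
       \<and> Edge \<alpha> \<beta> =
           (if sin (\<alpha> + \<beta>) \<noteq> 0
            then mod_2pi {(k, theta_0 \<alpha> \<beta> k) |k. k \<in> momenta \<alpha> \<beta> - {pi / 2, 3 * pi / 2}}
            else {})"
proof
  have "Bulk \<alpha> \<beta> = {(k, \<theta>). k \<in> momenta \<alpha> \<beta> \<and> cis \<theta> \<in> continuous_spectrum (cmv \<alpha> \<beta> k)}"
    unfolding Bulk_def by auto
  also have "\<dots> = {(k, \<theta>). k \<in> momenta \<alpha> \<beta> \<and> (\<exists>\<phi> n. \<theta> = \<phi> + 2 * pi * of_int n \<and>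
      \<phi> \<in> {theta_c \<alpha> \<beta> k..pi - theta_c \<alpha> \<beta> k} \<union> {pi + theta_c \<alpha> \<beta> k..2 * pi - theta_c \<alpha> \<beta> k})}"
    by (simp only: continuous_spectrum_cmv_iff cong: conj_cong)
  finally show "Bulk \<alpha> \<beta> = mod_2pi (\<Union>k\<in>momenta \<alpha> \<beta>.
           {k} \<times> ({theta_c \<alpha> \<beta> k..pi - theta_c \<alpha> \<beta> k} \<union>
                  {pi + theta_c \<alpha> \<beta> k..2 * pi - theta_c \<alpha> \<beta> k}))"
    unfolding mod_2pi_def by blast
  have "Edge \<alpha> \<beta> = {(k, \<theta>). k \<in> momenta \<alpha> \<beta> \<and> cis \<theta> \<in> point_spectrum (cmv \<alpha> \<beta> k)}"
    unfolding Edge_def by auto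
  also have "\<dots> = {(k, \<theta>). k \<in> momenta \<alpha> \<beta> \<and> sin (\<alpha> + \<beta>) \<noteq> 0 \<and> k \<notin> {pi / 2, 3 * pi / 2} \<and>
      (\<exists>n::int. \<theta> = theta_0 \<alpha> \<beta> k + 2 * pi * n)}"
    by (simp only: point_spectrum_cmv_iff cong: conj_cong)
  finally show "Edge \<alpha> \<beta> =
           (if sin (\<alpha> + \<beta>) \<noteq> 0
            then mod_2pi {(k, theta_0 \<alpha> \<beta> k) |k. k \<in> momenta \<alpha> \<beta> - {pi / 2, 3 * pi / 2}}
            else {})"
    unfolding mod_2pi_def by auto
qed

end
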